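(* Let $f:\Omega\to\mathbb{H}$ be a function. The following assertions are equivalent. \begin{itemize} \item[(a)] $f\in\mathcal{SR}(\Omega,\mathbb{H})$. \item[(a$'$)] $f\in\mathscr{C}^1_{\mathrm{sl}}(\Omega,\mathbb{H})$ and $\overline{\partial}_I f_I=0$ on $\Omega_I$ for all $I\in\mathbb{S}_{\mathbb{H}}$. \item[(b$'$)] $f\in\mathscr{C}^0_{\mathrm{sl}}(\Omega,\mathbb{H})$, $f_*\in\mathscr{C}^1(\Omega_*,\mathbb{H})$ and $f_*\in\ker(\overline{\vartheta})$. \end{itemize}
   Context: $\mathbb{H}$ is the real algebra of quaternions, with the Euclidean topology and real analytic structure of $\mathbb{R}^4$. $\mathbb{S}_{\mathbb{H}}=\{I\in\mathbb{H}:I^2=-1\}$ and, for $I\in\mathbb{S}_{\mathbb{H}}$, $\mathbb{C}_I=\{\alpha+I\beta:\alpha,\beta\in\mathbb{R}\}$. A subset of $\mathbb{H}$ is circular if it has the form $\Omega_E=\{\alpha+I\beta:\alpha,\beta\in\mathbb{R},\ \alpha+i\beta\in E,\ I\in\mathbb{S}_{\mathbb{H}}\}$ for some $E\subset\mathbb{C}$. Fixed throughout: $\Omega$ is a non-empty connected circular open subset of $\mathbb{H}$ with $\Omega\cap\mathbb{R}\neq\emptyset$, and $D\subset\mathbb{C}$ is the (non-empty, connected, open, conjugation-invariant) set with $\Omega=\Omega_D$, i.e. $D=\{\alpha+i\beta:\alpha+I\beta\in\Omega\text{ for all }I\in\mathbb{S}_{\mathbb{H}}\}$. Put $\Omega_I=\Omega\cap\mathbb{C}_I$,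 $\phi_I:D\to\Omega_I$, $\phi_I(\alpha+i\beta)=\alpha+I\beta$; $f_I=f|_{\Omega_I}$; $\Omega_*=\Omega\setminus\mathbb{R}$, $f_*=f|_{\Omega_*}$. For an open set $O\subset\mathbb{H}$, $\mathscr{C}^0(O,\mathbb{H})$ and $\mathscr{C}^1(O,\mathbb{H})$ are the sets of continuous, respectively $\mathscr{C}^1$ (in the real sense), functions $O\to\mathbb{H}$. $\mathscr{C}^0_{\mathrm{sl}}(\Omega,\mathbb{H})$ (slice-by-slice continuous functions) is the set of $f:\Omega\to\mathbb{H}$ such that $f_I$ is continuous for every $I\in\mathbb{S}_{\mathbb{H}}$; $\mathscr{C}^1_{\mathrm{sl}}(\Omega,\mathbb{H})$ (slice-by-slice $\mathscr{C}^1$ functions) is the set of $f:\Omega\to\mathbb{H}$ such that $f_I\circ\phi_I:D\to\mathbb{H}$ is of class $\mathscr{C}^1$ for every $I\in\mathbb{S}_{\mathbb{H}}$. If $g:\Omega_I\to\mathbb{H}$ is such that $g\circ\phi_I$ is $\mathscr{C}^1$, then $\overline{\partial}_I g(x)=\frac12\Big(\big(\frac{\partial}{\partial\alpha}+I\frac{\partial}{\partial\beta}\big)(g\circ\phi_I)\Big)(\phi_I^{-1}(x))$. The function $f$ is slice regular if $f\in\mathscr{C}^1(\Omega,\mathbb{H})$ and $\overline{\partial}_I f_I=0$ on $\Omega_I$ for all $I\in\mathbb{S}_{\mathbb{H}}$; $\mathcal{SR}(\Omega,\mathbb{H})$ is the set of such functions. Write $x=x_0+x_1i+x_2j+x_3k\in\mathbb{H}$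 with $x_h\in\mathbb{R}$, and $\mathrm{Im}(x)=x_1i+x_2j+x_3k$. The operator $\overline{\vartheta}:\mathscr{C}^1(\Omega_*,\mathbb{H})\to\mathscr{C}^0(\Omega_*,\mathbb{H})$ is $$\overline{\vartheta}=\frac12\Big(\frac{\partial}{\partial x_0}+\frac{\mathrm{Im}(x)}{|\mathrm{Im}(x)|^2}\sum_{h=1}^3x_h\frac{\partial}{\partial x_h}\Big)$$ (quaternionic factors multiply on the left). *)

theory Defs
  imports "HOL-Analysis.Analysis"
begin

section \<open>The real algebra of quaternions\<close>

codatatype quat = Quat (qRe: real) (qIm1: real) (qIm2: real) (qIm3: real)

lemma quat_eqI [intro?]:
  "\<lbrakk>qRe x = qRe y; qIm1 x = qIm1 y; qIm2 x = qIm2 y; qIm3 x = qIm3 y\<rbrakk> \<Longrightarrow> x = y"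
  by (rule quat.expand) simp

lemma quat_eq_iff:
  "x = y \<longleftrightarrow> qRe x = qRe y \<and> qIm1 x = qIm1 y \<and> qIm2 x = qIm2 y \<and> qIm3 x = qIm3 y"
  by (auto intro: quat.expand)

instantiation quat :: ab_group_add
begin

primcorec zero_quat where
  "qRe 0 = 0" | "qIm1 0 = 0" | "qIm2 0 = 0" | "qIm3 0 = 0"

primcorec plus_quat where
  "qRe (x + y) = qRe x + qRe y"
| "qIm1 (x + y) = qIm1 x + qIm1 y"
| "qIm2 (x + y) = qIm2 x + qIm2 y"
| "qIm3 (x + y) = qIm3 x + qIm3 y"

primcorec uminus_quat where
  "qRe (- x) = - qRe x"
| "qIm1 (- x) = - qIm1 x"
| "qIm2 (- x) = - qIm2 x"
| "qIm3 (- x) = - qIm3 x"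

primcorec minus_quat where
  "qRe (x - y) = qRe x - qRe y"
| "qIm1 (x - y) = qIm1 x - qIm1 y"
| "qIm2 (x - y) = qIm2 x - qIm2 y"
| "qIm3 (x - y) = qIm3 x - qIm3 y"

instance
  by standard (simp_all add: quat_eq_iff)

end

instantiation quat :: real_vector
begin

primcorec scaleR_quat where
  "qRe (scaleR r x) = r * qRe x"
| "qIm1 (scaleR r x) = r * qIm1 x"
| "qIm2 (scaleR r x) = r * qIm2 x"
| "qIm3 (scaleR r x) = r * qIm3 x"

instance
  by standard (simp_all add: quat_eq_iff algebra_simps)

end

instantiation quat :: ring_1
begin

primcorec one_quat where
  "qRe 1 = 1" | "qIm1 1 = 0" | "qIm2 1 = 0" | "qIm3 1 = 0"

primcorec times_quat where
  "qRe (x * y) = qRe x * qRe y - qIm1 x * qIm1 y - qIm2 x * qIm2 y - qIm3 x * qIm3 y"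
| "qIm1 (x * y) = qRe x * qIm1 y + qIm1 x * qRe y + qIm2 x * qIm3 y - qIm3 x * qIm2 y"
| "qIm2 (x * y) = qRe x * qIm2 y - qIm1 x * qIm3 y + qIm2 x * qRe y + qIm3 x * qIm1 y"
| "qIm3 (x * y) = qRe x * qIm3 y + qIm1 x * qIm2 y - qIm2 x * qIm1 y + qIm3 x * qRe y"

instance
proof
  fix x y z :: quat
  show "x * y * z = x * (y * z)"
    unfolding quat_eq_iff times_quat.sel by (intro conjI; algebra)
  show "(x + y) * z = x * z + y * z"
    unfolding quat_eq_iff times_quat.sel plus_quat.sel by (intro conjI; algebra)
  show "x * (y + z) = x * y + x * z"
    unfolding quat_eq_iff times_quat.sel plus_quat.sel by (intro conjI; algebra)
qed (simp_all add: quat_eq_iff)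

end

instance quat :: real_algebra_1
  by standard (simp_all add: quat_eq_iff algebra_simps)

lemma quat_sumsq_eq_0_iff:
  "(qRe x)\<^sup>2 + (qIm1 x)\<^sup>2 + (qIm2 x)\<^sup>2 + (qIm3 x)\<^sup>2 = 0 \<longleftrightarrow> x = 0"
  by (simp add: quat_eq_iff add_nonneg_eq_0_iff)

instantiation quat :: real_div_algebra
begin

definition
  "inverse (x :: quat) = Quat (qRe x) (- qIm1 x) (- qIm2 x) (- qIm3 x)
     /\<^sub>R ((qRe x)\<^sup>2 + (qIm1 x)\<^sup>2 + (qIm2 x)\<^sup>2 + (qIm3 x)\<^sup>2)"

definition "x div (y :: quat) = x * inverse y"

instance
proof
  fix x :: quat
  let ?s = "(qRe x)\<^sup>2 + (qIm1 x)\<^sup>2 + (qIm2 x)\<^sup>2 + (qIm3 x)\<^sup>2"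
  let ?c = "Quat (qRe x) (- qIm1 x) (- qIm2 x) (- qIm3 x)"
  have conj: "?c * x = of_real ?s" "x * ?c = of_real ?s"
    by (simp_all add: quat_eq_iff of_real_def power2_eq_square algebra_simps)
  assume "x \<noteq> 0"
  then have "?s \<noteq> 0"
    by (simp add: quat_sumsq_eq_0_iff)
  then show "inverse x * x = 1" "x * inverse x = 1"
    using conj by (simp_all add: inverse_quat_def of_real_def)
qed (simp_all add: divide_quat_def inverse_quat_def quat_eq_iff)

end

instantiation quat :: real_inner
begin

definition
  "inner (x :: quat) y = qRe x * qRe y + qIm1 x * qIm1 y + qIm2 x * qIm2 y + qIm3 x * qIm3 y"

definition
  "norm (x :: quat) = sqrt (inner x x)"

definition
  "sgn (x :: quat) = x /\<^sub>R norm x"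

definition
  "dist (x :: quat) y = norm (x - y)"

definition
  "(uniformity :: (quat \<times> quat) filter) = (INF e\<in>{0 <..}. principal {(x, y). dist x y < e})"

definition
  "open (U :: quat set) \<longleftrightarrow> (\<forall>x\<in>U. eventually (\<lambda>(x', y). x' = x \<longrightarrow> y \<in> U) uniformity)"

instance
proof
  fix x :: quat
  show "0 \<le> inner x x"
    by (simp add: inner_quat_def)
  show "inner x x = 0 \<longleftrightarrow> x = 0"
    using quat_sumsq_eq_0_iff [of x] by (simp add: inner_quat_def power2_eq_square)
next
  fix x y z :: quat and r :: real
  show "inner x y = inner y x"
    by (simp add: inner_quat_def mult.commute)
  show "inner (x + y) z = inner x z + inner y z"
    by (simp add: inner_quat_def algebra_simps)
  show "inner (r *\<^sub>R x) y = r * inner x y"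
    by (simp add: inner_quat_def algebra_simps)
qed (simp_all only: norm_quat_def sgn_quat_def dist_quat_def uniformity_quat_def open_quat_def)

end

lemma four_square_identity:
  fixes a b c d p q r t :: real
  shows "(a * p - b * q - c * r - d * t)\<^sup>2 + (a * q + b * p + c * t - d * r)\<^sup>2 +
         (a * r - b * t + c * p + d * q)\<^sup>2 + (a * t + b * r - c * q + d * p)\<^sup>2 =
         (a\<^sup>2 + b\<^sup>2 + c\<^sup>2 + d\<^sup>2) * (p\<^sup>2 + q\<^sup>2 + r\<^sup>2 + t\<^sup>2)"
  by algebra

instance quat :: real_normed_div_algebra
proof
  fix x y :: quat
  show "norm (x * y) = norm x * norm y"
    by (simp only: norm_quat_def real_sqrt_mult [symmetric] inner_quat_def times_quat.sel
        power2_eq_square [symmetric] four_square_identity)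
qed

definition quat_i :: quat where "quat_i = Quat 0 1 0 0"
definition quat_j :: quat where "quat_j = Quat 0 0 1 0"
definition quat_k :: quat where "quat_k = Quat 0 0 0 1"

lemmas quat_unit_defs = quat_i_def quat_j_def quat_k_def

lemma quat_units_mult:
  "quat_i * quat_i = -1" "quat_j * quat_j = -1" "quat_k * quat_k = -1"
  "quat_i * quat_j = quat_k" "quat_j * quat_k = quat_i" "quat_k * quat_i = quat_j"
  "quat_j * quat_i = - quat_k" "quat_k * quat_j = - quat_i" "quat_i * quat_k = - quat_j"
  by (simp_all add: quat_eq_iff quat_unit_defs)

lemma quat_of_real_simps [simp]:
  "qRe (of_real r) = r" "qIm1 (of_real r) = 0" "qIm2 (of_real r) = 0" "qIm3 (of_real r) = 0"
  by (simp_all add: of_real_def)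

lemma quat_decomp:
  "x = of_real (qRe x) + qIm1 x *\<^sub>R quat_i + qIm2 x *\<^sub>R quat_j + qIm3 x *\<^sub>R quat_k"
  by (simp add: quat_eq_iff quat_unit_defs)

instantiation quat :: euclidean_space
begin

definition Basis_quat :: "quat set" where
  "Basis = {1, quat_i, quat_j, quat_k}"

instance
proof
  show "(Basis :: quat set) \<noteq> {}" "finite (Basis :: quat set)"
    by (simp_all add: Basis_quat_def)
next
  fix u v :: quat
  assume "u \<in> Basis" "v \<in> Basis"
  then show "inner u v = (if u = v then 1 else 0)"
    unfolding Basis_quat_def
    by (elim insertE emptyE) (simp_all add: inner_quat_def quat_unit_defs quat_eq_iff)
next
  fix x :: quat
  show "(\<forall>u\<in>Basis. inner x u = 0) \<longleftrightarrow> x = 0"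
    unfolding Basis_quat_def ball_simps quat_unit_defs inner_quat_def
    by (simp add: quat_eq_iff)
qed

end

definition quat_Im :: "quat \<Rightarrow> quat" where
  "quat_Im x = qIm1 x *\<^sub>R quat_i + qIm2 x *\<^sub>R quat_j + qIm3 x *\<^sub>R quat_k"


section \<open>Functions of class \<open>C\<^sup>1\<close> and partial derivatives\<close>

text \<open>
  A function on an open set \<open>U\<close> is represented by a total function of which only the values
  on \<open>U\<close> matter: for open \<open>U\<close>, everything below depends only on the restriction to \<open>U\<close>.
\<close>

definition C1_on :: "'a::real_normed_vector set \<Rightarrow> ('a \<Rightarrow> 'b::real_normed_vector) set" where
  "C1_on U = {f. \<exists>f' :: 'a \<Rightarrow> 'a \<Rightarrow>\<^sub>L 'b.
     (\<forall>x\<in>U. (f has_derivative blinfun_apply (f' x)) (at x)) \<and> continuous_on U f'}"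

definition partial_deriv ::
  "'a::real_normed_vector \<Rightarrow> ('a \<Rightarrow> 'b::real_normed_vector) \<Rightarrow> 'a \<Rightarrow> 'b" where
  "partial_deriv v f x = vector_derivative (\<lambda>t::real. f (x + t *\<^sub>R v)) (at 0)"


section \<open>Circular sets and slices\<close>

definition imag_units :: "quat set" where
  "imag_units = {I. I\<^sup>2 = -1}"

definition slice_emb :: "quat \<Rightarrow> complex \<Rightarrow> quat" where
  "slice_emb I z = of_real (Re z) + I * of_real (Im z)"

definition slice_plane :: "quat \<Rightarrow> quat set" where
  "slice_plane I = {of_real \<alpha> + I * of_real \<beta> | \<alpha> \<beta>. True}"

definition circularization :: "complex set \<Rightarrow> quat set" where
  "circularization E =
     {of_real \<alpha> + I * of_real \<beta> | \<alpha> \<beta> I. Complex \<alpha> \<beta> \<in> E \<and> I \<in> imag_units}"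

definition circular :: "quat set \<Rightarrow> bool" where
  "circular \<Omega> \<longleftrightarrow> (\<exists>E. \<Omega> = circularization E)"

definition slice_base :: "quat set \<Rightarrow> complex set" where
  "slice_base \<Omega> = {Complex \<alpha> \<beta> | \<alpha> \<beta>. \<forall>I\<in>imag_units. of_real \<alpha> + I * of_real \<beta> \<in> \<Omega>}"

definition slice_part :: "quat set \<Rightarrow> quat \<Rightarrow> quat set" where
  "slice_part \<Omega> I = \<Omega> \<inter> slice_plane I"

definition nonreal_part :: "quat set \<Rightarrow> quat set" where
  "nonreal_part \<Omega> = \<Omega> - \<real>"

lemma slice_emb_inj:
  assumes "I \<in> imag_units"
  shows "inj (slice_emb I)"
proof (rule injI)
  fix z w assume "slice_emb I z = slice_emb I w"
  then have eq: "of_real (Re z - Re w) = I * of_real (Im w - Im z)"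
    by (simp add: slice_emb_def algebra_simps)
  have I2: "I * I = -1"
    using assms by (simp add: imag_units_def power2_eq_square)
  have "(of_real (Re z - Re w) :: quat) * of_real (Re z - Re w)
      = I * of_real (Im w - Im z) * of_real (Re z - Re w)"
    using eq by simp
  also have "\<dots> = I * (of_real (Re z - Re w) * of_real (Im w - Im z))"
    by (simp only: mult.assoc of_real_mult [symmetric] mult.commute [of "Re z - Re w"])
  also have "\<dots> = (I * I) * (of_real (Im w - Im z) * of_real (Im w - Im z))"
    by (simp only: eq mult.assoc)
  finally have "(of_real ((Re z - Re w)\<^sup>2) :: quat) = of_real (- (Im w - Im z)\<^sup>2)"
    by (simp add: I2 power2_eq_square)
  then have "(Re z - Re w)\<^sup>2 + (Im w - Im z)\<^sup>2 = 0"
    by (simp only: of_real_eq_iff)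
  then show "z = w"
    by (simp add: complex_eq_iff sum_power2_eq_zero_iff)
qed

lemma slice_emb_image:
  assumes "circular \<Omega>" and I: "I \<in> imag_units"
  shows "slice_emb I ` slice_base \<Omega> = slice_part \<Omega> I"
proof -
  obtain E where E: "\<Omega> = circularization E"
    using assms(1) by (auto simp: circular_def)
  have in_base: "z \<in> slice_base \<Omega>" if z: "slice_emb I z \<in> \<Omega>" for z
  proof -
    obtain \<alpha> \<beta> J where J: "Complex \<alpha> \<beta> \<in> E" "J \<in> imag_units"
      and eq: "slice_emb I z = of_real \<alpha> + J * of_real \<beta>"
      using z E by (auto simp: circularization_def)
    have unit: "qRe K = 0 \<and> (qIm1 K)\<^sup>2 + (qIm2 K)\<^sup>2 + (qIm3 K)\<^sup>2 = 1"
      if "K \<in> imag_units" for K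
    proof -
      have *: "qRe K * qRe K - qIm1 K * qIm1 K - qIm2 K * qIm2 K - qIm3 K * qIm3 K = -1"
        "2 * qRe K * qIm1 K = 0" "2 * qRe K * qIm2 K = 0" "2 * qRe K * qIm3 K = 0"
        using that by (auto simp: imag_units_def quat_eq_iff power2_eq_square)
      have "qRe K = 0"
      proof (rule ccontr)
        assume "qRe K \<noteq> 0"
        with * have "qRe K * qRe K = -1" by simp
        then show False
          by (smt (verit) zero_le_square)
      qed
      with * show ?thesis by (simp add: power2_eq_square)
    qed
    have re: "Re z = \<alpha>" and im: "qIm1 I * Im z = qIm1 J * \<beta>" "qIm2 I * Im z = qIm2 J * \<beta>"
      "qIm3 I * Im z = qIm3 J * \<beta>"
      using eq unit [OF I] unit [OF J(2)] by (simp_all add: slice_emb_def quat_eq_iff)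
    have "(Im z)\<^sup>2 = ((qIm1 I)\<^sup>2 + (qIm2 I)\<^sup>2 + (qIm3 I)\<^sup>2) * (Im z)\<^sup>2"
      using unit [OF I] by simp
    also have "\<dots> = (qIm1 I * Im z)\<^sup>2 + (qIm2 I * Im z)\<^sup>2 + (qIm3 I * Im z)\<^sup>2"
      by (simp add: algebra_simps power_mult_distrib)
    also have "\<dots> = ((qIm1 J)\<^sup>2 + (qIm2 J)\<^sup>2 + (qIm3 J)\<^sup>2) * \<beta>\<^sup>2"
      unfolding im by (simp add: algebra_simps power_mult_distrib)
    also have "\<dots> = \<beta>\<^sup>2"
      using unit [OF J(2)] by simp
    finally have pm: "Im z = \<beta> \<or> Im z = - \<beta>"
      by (simp add: power2_eq_iff)
    have "of_real (Re z) + K * of_real (Im z) \<in> \<Omega>" if K: "K \<in> imag_units" for K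
    proof -
      have "- K \<in> imag_units"
        using K by (simp add: imag_units_def)
      moreover have "of_real (Re z) + K * of_real (Im z) = of_real \<alpha> + K * of_real \<beta> \<or>
          of_real (Re z) + K * of_real (Im z) = of_real \<alpha> + (- K) * of_real \<beta>"
        using pm re by auto
      ultimately show ?thesis
        unfolding E circularization_def using J(1) K by blast
    qed
    then show ?thesis
      unfolding slice_base_def mem_Collect_eq
      by (intro exI [of _ "Re z"] exI [of _ "Im z"]) simp
  qed
  show ?thesis
  proof (intro equalityI subsetI)
    fix x assume "x \<in> slice_emb I ` slice_base \<Omega>"
    then show "x \<in> slice_part \<Omega> I"
      using I by (auto simp: slice_base_def slice_part_def slice_plane_def slice_emb_def)
  next
    fix x assume x: "x \<in> slice_part \<Omega> I"
    then obtain \<alpha> \<beta> where "x = slice_emb I (Complex \<alpha> \<beta>)"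
      by (auto simp: slice_part_def slice_plane_def slice_emb_def)
    with x in_base show "x \<in> slice_emb I ` slice_base \<Omega>"
      by (auto simp: slice_part_def)
  qed
qed


section \<open>Spaces of functions on slices and differential operators\<close>

definition C0_sl :: "quat set \<Rightarrow> (quat \<Rightarrow> quat) set" where
  "C0_sl \<Omega> = {f. \<forall>I\<in>imag_units. continuous_on (slice_part \<Omega> I) f}"

definition C1_sl :: "quat set \<Rightarrow> (quat \<Rightarrow> quat) set" where
  "C1_sl \<Omega> = {f. \<forall>I\<in>imag_units. f \<circ> slice_emb I \<in> C1_on (slice_base \<Omega>)}"

text \<open>
  For \<open>I \<in> imag_units\<close> the map \<open>slice_emb I\<close> is injective on all of \<open>\<complex>\<close> and maps
  \<open>slice_base \<Omega>\<close> onto \<open>slice_part \<Omega> I\<close>, so \<open>inv (slice_emb I)\<close> restricts to the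
  inverse of the parametrization of the slice.
\<close>

definition dbar_slice :: "quat \<Rightarrow> (quat \<Rightarrow> quat) \<Rightarrow> quat \<Rightarrow> quat" where
  "dbar_slice I g x = (let z = inv (slice_emb I) x; h = g \<circ> slice_emb I in
     (1/2) *\<^sub>R (partial_deriv 1 h z + I * partial_deriv \<i> h z))"

definition slice_regular :: "quat set \<Rightarrow> (quat \<Rightarrow> quat) set" where
  "slice_regular \<Omega> =
     {f \<in> C1_on \<Omega>. \<forall>I\<in>imag_units. \<forall>x\<in>slice_part \<Omega> I. dbar_slice I f x = 0}"

definition theta_bar :: "(quat \<Rightarrow> quat) \<Rightarrow> quat \<Rightarrow> quat" where
  "theta_bar f x = (1/2) *\<^sub>R (partial_deriv 1 f x +
     (quat_Im x /\<^sub>R (norm (quat_Im x))\<^sup>2) *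
       (qIm1 x *\<^sub>R partial_deriv quat_i f x + qIm2 x *\<^sub>R partial_deriv quat_j f x
        + qIm3 x *\<^sub>R partial_deriv quat_k f x))"

end

theory Submission
  imports Defs "HOL-Complex_Analysis.Complex_Analysis"
begin

text \<open>
  All conditions are equivalent to a fourth one: for every imaginary unit \<open>K\<close>, the function
  \<open>f \<circ> slice_emb K\<close> on the base \<open>D\<close> of \<open>\<Omega>\<close> is holomorphic for the complex structure that left
  multiplication by \<open>K\<close> defines on the quaternions (\<open>slice_holo\<close>).

  Both slicewise conditions lead to it. If the restrictions to the slices are \<open>C\<^sup>1\<close>, then the
  vanishing of \<open>dbar_slice\<close> is the Cauchy--Riemann equation. If \<open>f\<close> is only continuous on
  the slices, but \<open>C\<^sup>1\<close> off the real axis and in the kernel of \<open>theta_bar\<close>, then it is holomorphic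
  on the slices off the real line, because \<open>theta_bar\<close> coincides there with \<open>dbar_slice\<close>
  (\<open>theta_bar_eq_dbar_slice\<close>); the real line is a removable singularity by continuity
  (\<open>theta_bar_imp_slice_holo\<close>). Conversely, slice regularity implies both by restriction.

  The substance is that holomorphy on the slices forces \<open>f\<close> to be \<open>C\<^sup>1\<close> on \<open>\<Omega>\<close>, although nothing
  relates different slices except their common real points. By the identity principle these
  points suffice: \<open>D\<close> is connected and meets the real line, so the values of \<open>f\<close> at
  \<open>\<alpha> + I\<beta>\<close> and \<open>\<alpha> - I\<beta>\<close> determine its value at \<open>\<alpha> + K\<beta>\<close> for every \<open>K\<close>, by an explicit formula
  (\<open>slice_representation\<close>). Away from the real axis the formula shows that \<open>f\<close> is \<open>C\<^sup>1\<close>. Its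
  derivative there acts by the slice derivative along the slice and by the spherical
  derivative, a difference quotient over two conjugate points, across it. Holomorphy makes both tend
  to the same limit at a real point, and there the formula gives differentiability directly
  (\<open>has_derivative_real_point\<close>), so \<open>f\<close> is \<open>C\<^sup>1\<close> everywhere (\<open>slice_blend_C1\<close>).
\<close>

section \<open>Imaginary units and slices\<close>

lemma imag_unitsD:
  assumes "I \<in> imag_units"
  shows "I * I = -1" "norm I = 1" "- I \<in> imag_units" "qRe I = 0"
    "(qIm1 I)\<^sup>2 + (qIm2 I)\<^sup>2 + (qIm3 I)\<^sup>2 = 1"
proof -
  show II: "I * I = -1" and "- I \<in> imag_units"
    using assms by (simp_all add: imag_units_def power2_eq_square)
  have "norm I * norm I = 1"
    using arg_cong [OF II, of norm] by (simp add: norm_mult)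
  then show n: "norm I = 1"
    using norm_ge_zero [of I] by (auto simp: square_eq_1_iff)
  have "2 * qRe I * qIm1 I = 0" "2 * qRe I * qIm2 I = 0" "2 * qRe I * qIm3 I = 0"
    "qRe I * qRe I - qIm1 I * qIm1 I - qIm2 I * qIm2 I - qIm3 I * qIm3 I = -1"
    using II by (auto simp: quat_eq_iff)
  then show re: "qRe I = 0"
    by (smt (verit) mult_eq_0_iff zero_le_square)
  show "(qIm1 I)\<^sup>2 + (qIm2 I)\<^sup>2 + (qIm3 I)\<^sup>2 = 1"
    using n re by (simp add: norm_quat_def inner_quat_def power2_eq_square)
qed

lemma imag_unitsI:
  assumes "qRe I = 0" "norm I = 1"
  shows "I \<in> imag_units"
proof -
  have "(qIm1 I)\<^sup>2 + (qIm2 I)\<^sup>2 + (qIm3 I)\<^sup>2 = 1"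
    using assms by (simp add: norm_quat_def inner_quat_def power2_eq_square)
  with assms(1) show ?thesis
    by (simp add: imag_units_def quat_eq_iff power2_eq_square)
qed

lemma quat_i_imag_unit: "quat_i \<in> imag_units"
  by (simp add: imag_units_def power2_eq_square quat_units_mult)

lemma slice_emb_eq_scaleR: "slice_emb I z = Re z *\<^sub>R 1 + Im z *\<^sub>R I"
  by (simp add: slice_emb_def of_real_def)

lemma bounded_linear_slice_emb: "bounded_linear (slice_emb I)"
  unfolding slice_emb_eq_scaleR
  by (intro bounded_linear_add bounded_linear_scaleR_left [THEN bounded_linear_compose]
      bounded_linear_Re bounded_linear_Im)

lemma norm_slice_emb:
  assumes "I \<in> imag_units"
  shows "norm (slice_emb I z) = norm z"
proof -
  have "inner (slice_emb I z) (slice_emb I z) = (Re z)\<^sup>2 + (Im z)\<^sup>2 *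
      ((qIm1 I)\<^sup>2 + (qIm2 I)\<^sup>2 + (qIm3 I)\<^sup>2)"
    using imag_unitsD(4) [OF assms]
    by (simp add: slice_emb_eq_scaleR inner_quat_def algebra_simps power2_eq_square)
  then show ?thesis
    by (simp add: norm_quat_def imag_unitsD(5) [OF assms] cmod_def)
qed

section \<open>Functions that are holomorphic along one slice\<close>

text \<open>
  For an imaginary unit \<open>K\<close> this is the orthogonal projection of \<open>\<real>\<^sup>4\<close> onto the slice plane
  of \<open>K\<close>, read as a complex number. It turns left multiplication by \<open>\<alpha> + K\<beta>\<close> into complex
  multiplication by \<open>\<alpha> + i\<beta>\<close>, so the functionals \<open>\<lambda>x. slice_coord K (x * q)\<close>, with \<open>q\<close>
  ranging over all quaternions, are complex coordinates on the left \<open>\<complex>\<close>-vector space that \<open>K\<close>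
  makes of the quaternions. Using all \<open>q\<close> at once avoids the choice of a second imaginary
  unit orthogonal to \<open>K\<close>.
\<close>

definition slice_coord :: "quat \<Rightarrow> quat \<Rightarrow> complex" where
  "slice_coord K x = Complex (inner x 1) (inner x K)"

lemma bounded_linear_slice_coord: "bounded_linear (slice_coord K)"
proof -
  have "slice_coord K = (\<lambda>x. inner x 1 *\<^sub>R 1 + inner x K *\<^sub>R \<i>)"
    by (auto simp: slice_coord_def complex_eq_iff)
  then show ?thesis
    by (auto intro!: bounded_linear_add bounded_linear_scaleR_left [THEN bounded_linear_compose]
        bounded_linear_inner_left)
qed

lemma slice_coord_slice_emb_mult:
  assumes "K \<in> imag_units"
  shows "slice_coord K (slice_emb K v * q) = v * slice_coord K q"
proof -
  note u = imag_unitsD(4,5) [OF assms]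
  have "inner (slice_emb K v * q) 1 = Re v * inner q 1 - Im v * inner q K"
    using u(1) by (simp add: slice_emb_eq_scaleR inner_quat_def algebra_simps)
  moreover have "inner (slice_emb K v * q) K = Re v * inner q K +
      Im v * qRe q * ((qIm1 K)\<^sup>2 + (qIm2 K)\<^sup>2 + (qIm3 K)\<^sup>2)"
    using u(1)
    by (simp add: slice_emb_eq_scaleR inner_quat_def algebra_simps power2_eq_square)
  ultimately show ?thesis
    using u(2) by (simp add: slice_coord_def complex_eq_iff inner_quat_def)
qed

text \<open>
  The coordinates separate points: a non-zero difference \<open>d\<close> is detected by \<open>q = inverse d\<close>.
\<close>

lemma slice_coord_eqI:
  assumes "\<And>q. slice_coord K (x * q) = slice_coord K (y * q)"
  shows "x = y"
proof (rule ccontr)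
  interpret bounded_linear "slice_coord K" by (rule bounded_linear_slice_coord)
  assume "x \<noteq> y"
  have "slice_coord K ((x - y) * inverse (x - y)) = 0"
    using assms by (simp add: left_diff_distrib diff)
  then show False
    using \<open>x \<noteq> y\<close> by (simp add: slice_coord_def inner_quat_def complex_eq_iff)
qed

text \<open>
  The right factor is the conjugate of \<open>b\<close>. Every real coordinate is thus the real part of a
  complex coordinate, which is how real differentiability is recovered from holomorphy.
\<close>

lemma inner_eq_slice_coord:
  "inner x b = Re (slice_coord K (x * Quat (qRe b) (- qIm1 b) (- qIm2 b) (- qIm3 b)))"
  by (simp add: slice_coord_def inner_quat_def)

text \<open>
  The real derivative at \<open>z\<close> is complex linear for the structure given by \<open>K\<close>, so it is determined
  by its value \<open>c\<close> at \<open>1\<close>.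
\<close>

definition slice_holo :: "quat \<Rightarrow> complex set \<Rightarrow> (complex \<Rightarrow> quat) \<Rightarrow> bool" where
  "slice_holo K D F \<longleftrightarrow>
     (\<forall>z\<in>D. \<exists>c. (F has_derivative (\<lambda>v. slice_emb K v * c)) (at z))"

lemma slice_coord_holomorphic:
  assumes "K \<in> imag_units" and "slice_holo K D F"
  shows "(\<lambda>z. slice_coord K (F z * q)) holomorphic_on D"
proof (rule holomorphic_onI)
  fix z assume "z \<in> D"
  then obtain c where c: "(F has_derivative (\<lambda>v. slice_emb K v * c)) (at z)"
    using assms(2) by (auto simp: slice_holo_def)
  have "((\<lambda>z. slice_coord K (F z * q)) has_derivative
      (\<lambda>v. slice_coord K (slice_emb K v * c * q))) (at z)"
    by (intro bounded_linear.has_derivative [OF bounded_linear_slice_coord]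
        has_derivative_mult_left c)
  moreover have "(\<lambda>v. slice_coord K (slice_emb K v * c * q)) = (*) (slice_coord K (c * q))"
    by (simp add: fun_eq_iff mult.assoc slice_coord_slice_emb_mult [OF assms(1)])
  ultimately have "((\<lambda>z. slice_coord K (F z * q)) has_field_derivative slice_coord K (c * q)) (at z)"
    by (simp add: has_field_derivative_def)
  then show "(\<lambda>z. slice_coord K (F z * q)) field_differentiable at z within D"
    using field_differentiable_def field_differentiable_at_within by blast
qed

text \<open>
  If all coordinates of \<open>F\<close> are holomorphic, then so are, by Goursat, their derivatives, which
  makes the derivative of \<open>F\<close> continuous. That it has the form \<open>v \<mapsto> (\<alpha> + K\<beta>) c\<close> can be
  tested in the coordinates.
\<close>

lemma continuous_slice_derivative:
  assumes K: "K \<in> imag_units" and "open D"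
    and holo: "\<And>q. (\<lambda>z. slice_coord K (F z * q)) holomorphic_on D"
  obtains c where "continuous_on D c"
    "\<And>z. z \<in> D \<Longrightarrow> (F has_derivative (\<lambda>v. slice_emb K v * c z)) (at z)"
proof -
  define h where "h q z = slice_coord K (F z * q)" for q z
  define cnj where "cnj b = Quat (qRe b) (- qIm1 b) (- qIm2 b) (- qIm3 b)" for b
  define c where "c z = (\<Sum>b\<in>Basis. Re (deriv (h (cnj b)) z) *\<^sub>R b)" for z
  have h_holo: "h q holomorphic_on D" for q
    using holo [of q] by (simp add: h_def [abs_def])
  have h_deriv: "(h q has_derivative (\<lambda>v. deriv (h q) z * v)) (at z)" if "z \<in> D" for q z
    using holomorphic_derivI [OF h_holo \<open>open D\<close> that]
    by (simp add: has_field_derivative_def)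
  have F_eq: "F = (\<lambda>z. \<Sum>b\<in>Basis. Re (h (cnj b) z) *\<^sub>R b)"
    by (simp add: h_def cnj_def inner_eq_slice_coord [symmetric] euclidean_representation)
  have "(F has_derivative (\<lambda>v. slice_emb K v * c z)) (at z)" if z: "z \<in> D" for z
  proof -
    define L where "L v = (\<Sum>b\<in>Basis. Re (deriv (h (cnj b)) z * v) *\<^sub>R b)" for v
    have L: "(F has_derivative L) (at z)"
      unfolding F_eq L_def [abs_def]
      by (intro has_derivative_sum has_derivative_scaleR_left
          bounded_linear.has_derivative [OF bounded_linear_Re] h_deriv z)
    \<comment> \<open>By uniqueness of the derivative of the coordinate \<open>h q\<close>, the real linear map \<open>L\<close> is complex linear.\<close>
    have coord: "slice_coord K (L v * q) = v * slice_coord K (L 1 * q)" for v q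
    proof -
      have "(h q has_derivative (\<lambda>v. slice_coord K (L v * q))) (at z)"
        unfolding h_def
        by (intro bounded_linear.has_derivative [OF bounded_linear_slice_coord]
            has_derivative_mult_left L)
      then have "(\<lambda>v. slice_coord K (L v * q)) = (\<lambda>v. deriv (h q) z * v)"
        using h_deriv [OF z] by (rule has_derivative_unique)
      then have "slice_coord K (L w * q) = deriv (h q) z * w" for w
        by meson
      from this [of v] this [of 1] show ?thesis
        by simp
    qed
    have "L v = slice_emb K v * c z" for v
    proof (rule slice_coord_eqI)
      fix q
      have "L 1 = c z"
        by (simp add: L_def c_def)
      then show "slice_coord K (L v * q) = slice_coord K (slice_emb K v * c z * q)"
        by (metis coord mult.assoc slice_coord_slice_emb_mult [OF K])
    qed
    then have "L = (\<lambda>v. slice_emb K v * c z)"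
      by (rule ext)
    with L show ?thesis
      by simp
  qed
  moreover have "continuous_on D c"
    unfolding c_def
    by (intro continuous_intros holomorphic_on_imp_continuous_on holomorphic_deriv h_holo \<open>open D\<close>)
  ultimately show thesis
    using that by blast
qed

text \<open>
  The identity principle, applied to every coordinate. Real points of the open set \<open>D\<close> are limits
  of other real points of \<open>D\<close>.
\<close>

lemma slice_holo_eq_0:
  assumes K: "K \<in> imag_units" and D: "open D" "connected D"
    and F: "slice_holo K D F" and zero: "\<And>z. z \<in> D \<inter> \<real> \<Longrightarrow> F z = 0"
    and "of_real a \<in> D" and "w \<in> D"
  shows "F w = 0"
proof (rule slice_coord_eqI)
  fix q
  have lim: "(of_real a :: complex) islimpt D \<inter> \<real>"
  proof (rule islimptI)
    fix T assume "of_real a \<in> T" "open (T :: complex set)"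
    then have "open (T \<inter> D)" "of_real a \<in> T \<inter> D"
      using D assms(6) by auto
    then obtain e where e: "e > 0" "ball (of_real a) e \<subseteq> T \<inter> D"
      by (meson openE)
    have "of_real (a + e/2) \<in> ball (of_real a :: complex) e"
      using e(1) by (simp add: dist_norm norm_divide)
    moreover have "of_real (a + e/2) \<noteq> (of_real a :: complex)"
      using e(1) by (simp del: of_real_add)
    moreover have "of_real (a + e/2) \<in> (\<real> :: complex set)"
      by (rule Reals_of_real)
    ultimately show "\<exists>y\<in>D \<inter> \<real>. y \<in> T \<and> y \<noteq> of_real a"
      using e(2) by blast
  qed
  have "slice_coord K (F w * q) = 0"
  proof (rule analytic_continuation [OF slice_coord_holomorphic [OF K F] D Int_lower1])
    show "slice_coord K (F z * q) = 0" if "z \<in> D \<inter> \<real>" for z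
      using zero [OF that] by (simp add: slice_coord_def complex_eq_iff)
  qed (use assms lim in auto)
  then show "slice_coord K (F w * q) = slice_coord K (0 * q)"
    by (simp add: slice_coord_def complex_eq_iff)
qed

section \<open>The geometry of circular sets\<close>

lemma mem_slice_base_iff:
  assumes "circular \<Omega>" "I \<in> imag_units"
  shows "z \<in> slice_base \<Omega> \<longleftrightarrow> slice_emb I z \<in> \<Omega>"
proof -
  have "slice_emb I z \<in> slice_emb I ` slice_base \<Omega> \<longleftrightarrow> slice_emb I z \<in> \<Omega>"
    unfolding slice_emb_image [OF assms]
    by (auto simp: slice_part_def slice_plane_def slice_emb_def)
  then show ?thesis
    by (simp add: inj_image_mem_iff [OF slice_emb_inj [OF assms(2)]])
qed

lemma open_slice_base:
  assumes "circular \<Omega>" "open \<Omega>"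
  shows "open (slice_base \<Omega>)"
proof -
  have "slice_base \<Omega> = slice_emb quat_i -` \<Omega>"
    using mem_slice_base_iff [OF assms(1) quat_i_imag_unit] by auto
  then show ?thesis
    using open_vimage [OF assms(2)] linear_continuous_on [OF bounded_linear_slice_emb]
    by metis
qed

lemma slice_emb_cnj: "slice_emb I (cnj z) = slice_emb (- I) z"
  by (simp add: slice_emb_eq_scaleR)

lemma slice_emb_of_real: "slice_emb I (of_real a) = of_real a"
  by (simp add: slice_emb_def)

lemma slice_base_cnj:
  assumes "circular \<Omega>"
  shows "cnj z \<in> slice_base \<Omega> \<longleftrightarrow> z \<in> slice_base \<Omega>"
  using mem_slice_base_iff [OF assms quat_i_imag_unit]
    mem_slice_base_iff [OF assms imag_unitsD(3) [OF quat_i_imag_unit]]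
  by (metis slice_emb_cnj)

text \<open>
  A quaternion \<open>x\<close> off the real axis is \<open>slice_emb (slice_unit x) (slice_proj x)\<close>, where
  \<open>slice_proj x\<close> lies in the upper half plane. For real \<open>x\<close> the unit is a junk value, \<open>0\<close>, but
  then every imaginary unit serves.
\<close>

definition slice_proj :: "quat \<Rightarrow> complex" where
  "slice_proj x = Complex (qRe x) (norm (quat_Im x))"

definition slice_unit :: "quat \<Rightarrow> quat" where
  "slice_unit x = quat_Im x /\<^sub>R norm (quat_Im x)"

lemma quat_Im_sel [simp]:
  "qRe (quat_Im x) = 0" "qIm1 (quat_Im x) = qIm1 x"
  "qIm2 (quat_Im x) = qIm2 x" "qIm3 (quat_Im x) = qIm3 x"
  by (simp_all add: quat_Im_def quat_unit_defs)

lemma quat_Re_Im: "x = of_real (qRe x) + quat_Im x"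
  by (simp add: quat_eq_iff)

lemma quat_Im_eq_0_iff: "quat_Im x = 0 \<longleftrightarrow> x \<in> \<real>"
proof
  assume "quat_Im x = 0"
  then show "x \<in> \<real>"
    using quat_Re_Im [of x] by (metis Reals_of_real add.right_neutral)
next
  assume "x \<in> \<real>"
  then show "quat_Im x = 0"
    by (auto simp: Reals_def quat_eq_iff)
qed

lemma quat_Im_slice_emb:
  assumes "K \<in> imag_units"
  shows "quat_Im (slice_emb K z) = Im z *\<^sub>R K" "qRe (slice_emb K z) = Re z"
  using imag_unitsD(4) [OF assms] by (simp_all add: quat_eq_iff slice_emb_eq_scaleR)

lemma slice_emb_in_Reals_iff:
  assumes "K \<in> imag_units"
  shows "slice_emb K z \<in> \<real> \<longleftrightarrow> Im z = 0"
  using imag_unitsD(2) [OF assms]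
  by (auto simp: quat_Im_eq_0_iff [symmetric] quat_Im_slice_emb [OF assms])

lemma slice_unit_imag_unit:
  assumes "x \<notin> \<real>"
  shows "slice_unit x \<in> imag_units"
  using assms by (intro imag_unitsI) (simp_all add: slice_unit_def quat_Im_eq_0_iff)

lemma slice_emb_unit_proj:
  assumes "x \<notin> \<real>"
  shows "slice_emb (slice_unit x) (slice_proj x) = x"
  using quat_Re_Im [of x] assms
  by (simp add: slice_emb_eq_scaleR slice_proj_def slice_unit_def quat_Im_eq_0_iff of_real_def)

lemma slice_emb_proj_real:
  assumes "x \<in> \<real>"
  shows "slice_emb K (slice_proj x) = x" "cnj (slice_proj x) = slice_proj x"
proof -
  have "quat_Im x = 0"
    using assms by (simp add: quat_Im_eq_0_iff)
  then show "slice_emb K (slice_proj x) = x" "cnj (slice_proj x) = slice_proj x"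
    using quat_Re_Im [of x] by (simp_all add: slice_emb_def slice_proj_def complex_eq_iff)
qed

lemma slice_emb_proj:
  obtains K where "K \<in> imag_units" "slice_emb K (slice_proj x) = x"
  using slice_emb_unit_proj slice_unit_imag_unit slice_emb_proj_real(1) quat_i_imag_unit by metis

lemma slice_proj_in_base:
  assumes "circular \<Omega>" "x \<in> \<Omega>"
  shows "slice_proj x \<in> slice_base \<Omega>"
proof -
  obtain K where "K \<in> imag_units" "slice_emb K (slice_proj x) = x"
    using slice_emb_proj [of x] by blast
  then show ?thesis
    using assms mem_slice_base_iff by metis
qed

lemma bounded_linear_qRe: "bounded_linear qRe"
proof -
  have "qRe = (\<lambda>x. inner x 1)"
    by (simp add: inner_quat_def)
  then show ?thesis
    by (metis bounded_linear_inner_left)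
qed

lemma bounded_linear_quat_Im: "bounded_linear quat_Im"
proof -
  have "quat_Im = (\<lambda>x. x - qRe x *\<^sub>R 1)"
    by (simp add: quat_eq_iff fun_eq_iff)
  moreover have "bounded_linear (\<lambda>x. x - qRe x *\<^sub>R (1 :: quat))"
    by (intro bounded_linear_sub bounded_linear_ident bounded_linear_qRe
        bounded_linear_scaleR_left [THEN bounded_linear_compose])
  ultimately show ?thesis
    by simp
qed

lemma continuous_on_slice_proj [continuous_intros]:
  "continuous_on S slice_proj"
proof -
  have eq: "slice_proj = (\<lambda>x. of_real (qRe x) + \<i> * of_real (norm (quat_Im x)))"
    by (simp add: slice_proj_def complex_eq_iff fun_eq_iff)
  show ?thesis
    unfolding eq
    by (intro continuous_intros bounded_linear.continuous_on [OF bounded_linear_qRe]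
        bounded_linear.continuous_on [OF bounded_linear_quat_Im])
qed

lemma slice_proj_slice_emb:
  assumes "K \<in> imag_units"
  shows "slice_proj (slice_emb K z) = Complex (Re z) \<bar>Im z\<bar>"
  by (simp add: slice_proj_def quat_Im_slice_emb [OF assms] imag_unitsD(2) [OF assms])

text \<open>
  The part of the base in the closed upper half plane is the image of \<open>\<Omega>\<close> under \<open>slice_proj\<close> and
  hence connected. The base is the union of this part and its mirror image, which meet at a real
  point.
\<close>

lemma connected_slice_base:
  assumes "circular \<Omega>" "connected \<Omega>" "\<Omega> \<inter> \<real> \<noteq> {}"
  shows "connected (slice_base \<Omega>)"
proof -
  obtain a where a: "of_real a \<in> \<Omega>"
    using assms(3) by (auto simp: Reals_def)
  let ?P = "slice_proj ` \<Omega>"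
  have sub: "?P \<subseteq> slice_base \<Omega>"
    using slice_proj_in_base [OF assms(1)] by blast
  have P: "connected ?P"
    by (intro connected_continuous_image continuous_intros assms)
  have "z \<in> ?P \<union> cnj ` ?P" if z: "z \<in> slice_base \<Omega>" for z
  proof -
    have "slice_emb quat_i z \<in> \<Omega>"
      using z mem_slice_base_iff [OF assms(1) quat_i_imag_unit] by blast
    then have *: "Complex (Re z) \<bar>Im z\<bar> \<in> ?P"
      using slice_proj_slice_emb [OF quat_i_imag_unit] by (metis imageI)
    show ?thesis
    proof (cases "Im z \<ge> 0")
      case True
      then show ?thesis
        using * by (simp add: complex_surj)
    next
      case False
      then have "z = cnj (Complex (Re z) \<bar>Im z\<bar>)"
        by (simp add: complex_eq_iff)
      then show ?thesis
        using * by (metis UnI2 imageI)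
    qed
  qed
  moreover have "cnj ` ?P \<subseteq> slice_base \<Omega>"
    using sub slice_base_cnj [OF assms(1)] by blast
  ultimately have "slice_base \<Omega> = ?P \<union> cnj ` ?P"
    using sub by blast
  moreover have "connected (?P \<union> cnj ` ?P)"
  proof (rule connected_Un)
    show "connected (cnj ` ?P)"
      by (intro connected_continuous_image continuous_intros P)
    have r: "slice_proj (of_real a) = of_real a"
      by (simp add: slice_proj_def quat_eq_iff complex_eq_iff quat_Im_def)
    have "of_real a \<in> ?P" "cnj (of_real a) \<in> cnj ` ?P"
      using r a by (metis imageI)+
    then show "?P \<inter> cnj ` ?P \<noteq> {}"
      by auto
  qed (rule P)
  ultimately show ?thesis
    by simp
qed

section \<open>The representation formula\<close>

text \<open>
  The representation formula of slice analysis: from the values \<open>a\<close> and \<open>b\<close> at \<open>\<alpha> + I\<beta>\<close> and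
  \<open>\<alpha> - I\<beta>\<close> it computes the value at \<open>\<alpha> + K\<beta>\<close>.
\<close>

definition slice_blend :: "quat \<Rightarrow> quat \<Rightarrow> quat \<Rightarrow> quat \<Rightarrow> quat" where
  "slice_blend I K a b = (1/2) *\<^sub>R ((1 - K * I) * a + (1 + K * I) * b)"

lemma slice_blend_self [simp]: "slice_blend I K a a = a"
proof -
  have "(1 - K * I) * a + (1 + K * I) * a = 2 *\<^sub>R a"
    by (simp add: algebra_simps scaleR_2)
  then show ?thesis
    by (simp add: slice_blend_def)
qed

lemma slice_blend_diff: "slice_blend I K a b - slice_blend I K a' b' = slice_blend I K (a - a') (b - b')"
  by (simp add: slice_blend_def algebra_simps flip: scaleR_right_diff_distrib)

lemma norm_slice_blend_le:
  assumes "I \<in> imag_units" "K \<in> imag_units"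
  shows "norm (slice_blend I K a b) \<le> norm a + norm b"
proof -
  have n: "norm (K * I) = 1"
    using assms by (simp add: norm_mult imag_unitsD(2))
  have "norm (1 - K * I) \<le> 2" "norm (1 + K * I) \<le> 2"
    using norm_triangle_ineq4 [of 1 "K * I"] norm_triangle_ineq [of 1 "K * I"] n by auto
  then have "norm ((1 - K * I) * a + (1 + K * I) * b) \<le> 2 * norm a + 2 * norm b"
    by (intro norm_triangle_le add_mono) (simp_all add: norm_mult mult_right_mono)
  then show ?thesis
    by (simp add: slice_blend_def)
qed

text \<open>
  Everything rests on this identity, a consequence of \<open>(1 - K I) I = K (1 - K I)\<close> and
  \<open>(1 + K I) (- I) = K (1 + K I)\<close>: blending turns the complex structure \<open>I\<close> on the first argument
  and \<open>- I\<close> on the second into the complex structure \<open>K\<close>.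
\<close>

lemma slice_blend_slice_emb:
  assumes "I \<in> imag_units" "K \<in> imag_units"
  shows "slice_blend I K (slice_emb I v * a) (slice_emb I (cnj v) * b)
    = slice_emb K v * slice_blend I K a b"
proof -
  have II: "I * (I * x) = - x" and KK: "K * (K * x) = - x" for x
    using imag_unitsD(1) [OF assms(1)] imag_unitsD(1) [OF assms(2)]
    by (simp_all add: mult.assoc [symmetric])
  show ?thesis
    by (simp add: slice_blend_def slice_emb_eq_scaleR algebra_simps II KK)
qed

lemma has_derivative_slice_blend:
  assumes "(F has_derivative F') net" "(G has_derivative G') net"
  shows "((\<lambda>z. slice_blend I K (F z) (G z)) has_derivative (\<lambda>v. slice_blend I K (F' v) (G' v))) net"
  unfolding slice_blend_def
  by (intro has_derivative_scaleR_right has_derivative_add has_derivative_mult_right assms)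

text \<open>
  As functions of \<open>z\<close> both sides are holomorphic for the complex structure \<open>K\<close>, the right one
  because blending intertwines the structures, and they agree at the real points. The identity
  principle on the connected base does the rest.
\<close>

lemma slice_representation:
  assumes \<Omega>: "open \<Omega>" "connected \<Omega>" "circular \<Omega>" "\<Omega> \<inter> \<real> \<noteq> {}"
    and holo: "\<And>K. K \<in> imag_units \<Longrightarrow> slice_holo K (slice_base \<Omega>) (f \<circ> slice_emb K)"
    and I: "I \<in> imag_units" and K: "K \<in> imag_units" and z: "z \<in> slice_base \<Omega>"
  shows "f (slice_emb K z) = slice_blend I K (f (slice_emb I z)) (f (slice_emb I (cnj z)))"
proof -
  let ?D = "slice_base \<Omega>" and ?F = "f \<circ> slice_emb I"
  define g where "g z = f (slice_emb K z) - slice_blend I K (?F z) (?F (cnj z))" for z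
  obtain a where "of_real a \<in> \<Omega>"
    using \<Omega>(4) by (auto simp: Reals_def)
  then have a: "of_real a \<in> ?D"
    using mem_slice_base_iff [OF \<Omega>(3) I] by (simp add: slice_emb_of_real)
  have "g z = 0"
  proof (rule slice_holo_eq_0 [OF K _ _ _ _ a z])
    show "open ?D" "connected ?D"
      using open_slice_base connected_slice_base \<Omega> by blast+
    show "g w = 0" if "w \<in> ?D \<inter> \<real>" for w
      using that by (auto simp: g_def slice_emb_of_real Reals_def)
    show "slice_holo K ?D g"
      unfolding slice_holo_def
    proof
      fix w assume w: "w \<in> ?D"
      then have cw: "cnj w \<in> ?D"
        by (simp add: slice_base_cnj [OF \<Omega>(3)])
      obtain c0 c1 c2 where
        c0: "((f \<circ> slice_emb K) has_derivative (\<lambda>v. slice_emb K v * c0)) (at w)" and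
        c1: "(?F has_derivative (\<lambda>v. slice_emb I v * c1)) (at w)" and
        c2: "(?F has_derivative (\<lambda>v. slice_emb I v * c2)) (at (cnj w))"
        using holo [OF I] holo [OF K] w cw unfolding slice_holo_def by meson
      have "((\<lambda>z. ?F (cnj z)) has_derivative (\<lambda>v. slice_emb I (cnj v) * c2)) (at w)"
        using has_derivative_compose [OF bounded_linear_imp_has_derivative [OF bounded_linear_cnj] c2]
        by simp
      from has_derivative_diff [OF c0 has_derivative_slice_blend [OF c1 this, of I K]]
      have "(g has_derivative (\<lambda>v. slice_emb K v * (c0 - slice_blend I K c1 c2))) (at w)"
        by (simp add: g_def [abs_def] slice_blend_slice_emb [OF I K] algebra_simps)
      then show "\<exists>c. (g has_derivative (\<lambda>v. slice_emb K v * c)) (at w)" ..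
    qed
  qed
  then show ?thesis
    by (simp add: g_def)
qed

section \<open>Continuous differentiability and the differential operators\<close>

text \<open>
  In finite dimension, continuity of the derivative in the operator norm may be tested on each
  vector separately.
\<close>

lemma C1_onI:
  fixes f :: "'a::euclidean_space \<Rightarrow> 'b::real_normed_vector"
  assumes deriv: "\<And>x. x \<in> U \<Longrightarrow> (f has_derivative f' x) (at x)"
    and cont: "\<And>h. continuous_on U (\<lambda>x. f' x h)"
  shows "f \<in> C1_on U"
  unfolding C1_on_def mem_Collect_eq
proof (intro exI conjI ballI)
  let ?f' = "\<lambda>x. Blinfun (f' x)"
  have Blinfun_f': "blinfun_apply (?f' x) = f' x" if "x \<in> U" for x
    using deriv [OF that] by (intro bounded_linear_Blinfun_apply has_derivative_bounded_linear)
  show "(f has_derivative blinfun_apply (?f' x)) (at x)" if "x \<in> U" for x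
    using deriv [OF that] that by (simp add: Blinfun_f')
  show "continuous_on U ?f'"
  proof (rule continuous_on_blinfun_componentwise)
    show "continuous_on U (\<lambda>x. blinfun_apply (?f' x) h)" for h
      using cont [of h] by (rule continuous_on_eq) (simp add: Blinfun_f')
  qed
qed

lemma C1_onD:
  assumes "f \<in> C1_on U"
  obtains f' where "\<And>x. x \<in> U \<Longrightarrow> (f has_derivative f' x) (at x)"
    "\<And>h. continuous_on U (\<lambda>x. f' x h)"
proof -
  obtain f' where "\<forall>x\<in>U. (f has_derivative blinfun_apply (f' x)) (at x)" and "continuous_on U f'"
    using assms by (auto simp: C1_on_def)
  moreover from this(2) have "continuous_on U (\<lambda>x. blinfun_apply (f' x) h)" for h
    by (intro continuous_intros)
  ultimately show thesis
    using that [of "\<lambda>x. blinfun_apply (f' x)"] by blast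
qed

lemma C1_on_subset: "f \<in> C1_on U \<Longrightarrow> V \<subseteq> U \<Longrightarrow> f \<in> C1_on V"
  unfolding C1_on_def mem_Collect_eq by (elim exE conjE) (blast intro: continuous_on_subset)

lemma partial_deriv_eq:
  assumes "(f has_derivative f') (at x)"
  shows "partial_deriv v f x = f' v"
proof -
  have "((\<lambda>t::real. x + t *\<^sub>R v) has_derivative (\<lambda>t. t *\<^sub>R v)) (at 0)"
    by (auto intro!: derivative_eq_intros)
  moreover have "(f has_derivative f') (at (x + 0 *\<^sub>R v))"
    using assms by simp
  ultimately have "((\<lambda>t. f (x + t *\<^sub>R v)) has_derivative (\<lambda>t. f' (t *\<^sub>R v))) (at 0)"
    by (rule has_derivative_compose)
  then have "((\<lambda>t. f (x + t *\<^sub>R v)) has_vector_derivative f' v) (at 0)"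
    by (simp add: has_vector_derivative_def linear_scale [OF has_derivative_linear [OF assms]])
  then show ?thesis
    by (simp add: partial_deriv_def vector_derivative_at)
qed

lemma dbar_slice_eq:
  assumes "I \<in> imag_units" "(f \<circ> slice_emb I has_derivative F') (at z)"
  shows "dbar_slice I f (slice_emb I z) = (1/2) *\<^sub>R (F' 1 + I * F' \<i>)"
  using partial_deriv_eq [OF assms(2)]
  by (simp add: dbar_slice_def Let_def inv_f_f [OF slice_emb_inj [OF assms(1)]])

lemma complex_linear_expand:
  fixes L :: "complex \<Rightarrow> 'a::real_vector"
  assumes "linear L"
  shows "L v = Re v *\<^sub>R L 1 + Im v *\<^sub>R L \<i>"
proof -
  have "L (Re v *\<^sub>R 1 + Im v *\<^sub>R \<i>) = Re v *\<^sub>R L 1 + Im v *\<^sub>R L \<i>"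
    by (simp only: linear_add [OF assms] linear_scale [OF assms])
  moreover have "Re v *\<^sub>R 1 + Im v *\<^sub>R \<i> = v"
    by (simp add: complex_eq_iff)
  ultimately show ?thesis
    by simp
qed

text \<open>
  Left multiplication by \<open>I\<close> is invertible, with square \<open>- 1\<close>. With \<open>a\<close> and \<open>b\<close> the two partial
  derivatives, this is the step from the Cauchy--Riemann equation to complex linearity.
\<close>

lemma cauchy_riemann_iff:
  assumes "I \<in> imag_units"
  shows "a + I * b = 0 \<longleftrightarrow> b = I * a"
proof -
  have II: "I * (I * x) = - x" for x
    using imag_unitsD(1) [OF assms] by (simp add: mult.assoc [symmetric])
  show ?thesis
  proof
    assume "a + I * b = 0"
    then have "I * (a + I * b) = 0"
      by simp
    then show "b = I * a"
      by (simp add: distrib_left II)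
  qed (simp add: II)
qed

lemma dbar_slice_eq_0_iff:
  assumes I: "I \<in> imag_units" and F: "(f \<circ> slice_emb I has_derivative F') (at z)"
  shows "dbar_slice I f (slice_emb I z) = 0 \<longleftrightarrow> F' = (\<lambda>v. slice_emb I v * F' 1)"
proof -
  have "dbar_slice I f (slice_emb I z) = 0 \<longleftrightarrow> F' \<i> = I * F' 1"
    by (simp add: dbar_slice_eq [OF assms] cauchy_riemann_iff [OF I])
  also have "\<dots> \<longleftrightarrow> F' = (\<lambda>v. slice_emb I v * F' 1)"
  proof
    assume *: "F' \<i> = I * F' 1"
    show "F' = (\<lambda>v. slice_emb I v * F' 1)"
    proof
      show "F' v = slice_emb I v * F' 1" for v
        using complex_linear_expand [OF has_derivative_linear [OF F], of v]
        by (simp add: * slice_emb_eq_scaleR algebra_simps)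
    qed
  next
    assume "F' = (\<lambda>v. slice_emb I v * F' 1)"
    then have "F' \<i> = slice_emb I \<i> * F' 1"
      by (rule fun_cong)
    then show "F' \<i> = I * F' 1"
      by (simp add: slice_emb_eq_scaleR)
  qed
  finally show ?thesis .
qed

section \<open>Passing between the global and the slicewise conditions\<close>

lemma has_derivative_comp_slice_emb:
  assumes "(f has_derivative f') (at (slice_emb I z))"
  shows "(f \<circ> slice_emb I has_derivative (\<lambda>v. f' (slice_emb I v))) (at z)"
  using has_derivative_compose [OF bounded_linear_imp_has_derivative [OF bounded_linear_slice_emb] assms]
  by (simp add: o_def)

lemma C1_on_imp_C1_sl:
  assumes "circular \<Omega>" and "f \<in> C1_on \<Omega>"
  shows "f \<in> C1_sl \<Omega>"
  unfolding C1_sl_def mem_Collect_eq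
proof
  fix I assume I: "I \<in> imag_units"
  obtain f' where f': "\<And>x. x \<in> \<Omega> \<Longrightarrow> (f has_derivative f' x) (at x)"
    and cont: "\<And>h. continuous_on \<Omega> (\<lambda>x. f' x h)"
    using C1_onD [OF assms(2)] by blast
  show "f \<circ> slice_emb I \<in> C1_on (slice_base \<Omega>)"
  proof (rule C1_onI)
    show "(f \<circ> slice_emb I has_derivative (\<lambda>v. f' (slice_emb I z) (slice_emb I v))) (at z)"
      if "z \<in> slice_base \<Omega>" for z
      using that f' has_derivative_comp_slice_emb mem_slice_base_iff [OF assms(1) I] by blast
    show "continuous_on (slice_base \<Omega>) (\<lambda>z. f' (slice_emb I z) (slice_emb I v))" for v
      using mem_slice_base_iff [OF assms(1) I]
      by (intro continuous_on_compose2 [OF cont linear_continuous_on [OF bounded_linear_slice_emb]])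
        blast
  qed
qed

lemma C1_sl_imp_slice_holo:
  assumes "circular \<Omega>" "f \<in> C1_sl \<Omega>" and I: "I \<in> imag_units"
    and dbar: "\<forall>x\<in>slice_part \<Omega> I. dbar_slice I f x = 0"
  shows "slice_holo I (slice_base \<Omega>) (f \<circ> slice_emb I)"
  unfolding slice_holo_def
proof
  fix z assume z: "z \<in> slice_base \<Omega>"
  obtain F' where F': "(f \<circ> slice_emb I has_derivative F') (at z)"
    using assms(2) I z unfolding C1_sl_def by (blast elim: C1_onD)
  have "dbar_slice I f (slice_emb I z) = 0"
    using dbar z slice_emb_image [OF assms(1) I] by blast
  then have "F' = (\<lambda>v. slice_emb I v * F' 1)"
    using dbar_slice_eq_0_iff [OF I F'] by blast
  with F' show "\<exists>c. (f \<circ> slice_emb I has_derivative (\<lambda>v. slice_emb I v * c)) (at z)"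
    by metis
qed

lemma slice_holo_imp_dbar_slice_eq_0:
  assumes "circular \<Omega>" and I: "I \<in> imag_units"
    and holo: "slice_holo I (slice_base \<Omega>) (f \<circ> slice_emb I)" and x: "x \<in> slice_part \<Omega> I"
  shows "dbar_slice I f x = 0"
proof -
  obtain z where z: "z \<in> slice_base \<Omega>" "x = slice_emb I z"
    using x slice_emb_image [OF assms(1) I] by blast
  then obtain c where "(f \<circ> slice_emb I has_derivative (\<lambda>v. slice_emb I v * c)) (at z)"
    using holo unfolding slice_holo_def by blast
  from dbar_slice_eq_0_iff [OF I this] show ?thesis
    by (simp add: z slice_emb_def)
qed

text \<open>
  The radial field \<open>\<Sum>h. x\<^sub>h \<partial>/\<partial>x\<^sub>h\<close> at \<open>x = \<alpha> + I\<beta>\<close> is the derivative in the direction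
  \<open>\<beta> I\<close>, and \<open>Im x / |Im x|\<^sup>2 = I / \<beta>\<close>, so the factor \<open>\<beta>\<close> cancels whatever its sign. Off the real
  axis the global operator therefore acts slice by slice.
\<close>

lemma theta_bar_eq_dbar_slice:
  assumes I: "I \<in> imag_units" and "Im z \<noteq> 0"
    and f': "(f has_derivative f') (at (slice_emb I z))"
  shows "theta_bar f (slice_emb I z) = dbar_slice I f (slice_emb I z)"
proof -
  let ?x = "slice_emb I z"
  note lin = has_derivative_linear [OF f']
  have "qIm1 ?x *\<^sub>R f' quat_i + qIm2 ?x *\<^sub>R f' quat_j + qIm3 ?x *\<^sub>R f' quat_k = f' (quat_Im ?x)"
    unfolding quat_Im_def by (simp only: linear_add [OF lin] linear_scale [OF lin])
  also have "\<dots> = Im z *\<^sub>R f' I"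
    by (simp add: quat_Im_slice_emb [OF I] linear_scale [OF lin])
  finally have "theta_bar f ?x = (1/2) *\<^sub>R (f' 1 + ((Im z *\<^sub>R I) /\<^sub>R (Im z)\<^sup>2) * (Im z *\<^sub>R f' I))"
    unfolding theta_bar_def partial_deriv_eq [OF f']
    by (simp add: quat_Im_slice_emb [OF I] imag_unitsD(2) [OF I])
  also have "\<dots> = (1/2) *\<^sub>R (f' 1 + I * f' I)"
    using assms(2) by (simp add: power2_eq_square flip: mult.assoc)
  also have "\<dots> = dbar_slice I f ?x"
    unfolding dbar_slice_eq [OF I has_derivative_comp_slice_emb [OF f']]
    by (simp add: slice_emb_eq_scaleR)
  finally show ?thesis .
qed

lemma slice_regular_imp_theta_bar:
  assumes "f \<in> slice_regular \<Omega>" "x \<in> nonreal_part \<Omega>"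
  shows "theta_bar f x = 0"
proof -
  have x: "x \<in> \<Omega>" "x \<notin> \<real>"
    using assms(2) by (auto simp: nonreal_part_def)
  obtain K where K: "K \<in> imag_units" and xK: "slice_emb K (slice_proj x) = x"
    using slice_emb_proj [of x] by blast
  obtain f' where "(f has_derivative f') (at x)"
    using assms(1) x unfolding slice_regular_def by (blast elim: C1_onD)
  then have "theta_bar f x = dbar_slice K f x"
    using theta_bar_eq_dbar_slice [OF K, of "slice_proj x"] slice_emb_in_Reals_iff [OF K] x(2)
    by (metis xK)
  moreover have "slice_emb K (slice_proj x) \<in> slice_plane K"
    by (auto simp: slice_plane_def slice_emb_def)
  then have "x \<in> slice_part \<Omega> K"
    using x(1) xK by (simp add: slice_part_def)
  ultimately show ?thesis
    using assms(1) K by (simp add: slice_regular_def)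
qed

text \<open>
  The differential equation makes the coordinates holomorphic off the real line, and by
  hypothesis they are continuous across it. By Morera's theorem they are holomorphic on all of
  the base.
\<close>

lemma theta_bar_imp_slice_holo:
  assumes \<Omega>: "open \<Omega>" "circular \<Omega>" and I: "I \<in> imag_units"
    and cont: "f \<in> C0_sl \<Omega>" and C1: "f \<in> C1_on (nonreal_part \<Omega>)"
    and theta: "\<forall>x\<in>nonreal_part \<Omega>. theta_bar f x = 0"
  shows "slice_holo I (slice_base \<Omega>) (f \<circ> slice_emb I)"
proof -
  let ?D = "slice_base \<Omega>" and ?F = "f \<circ> slice_emb I"
  have D: "open ?D"
    by (rule open_slice_base [OF \<Omega>(2,1)])
  have F_cont: "continuous_on ?D ?F"
    using cont I linear_continuous_on [OF bounded_linear_slice_emb]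
    by (intro continuous_on_compose) (auto simp: C0_sl_def slice_emb_image [OF \<Omega>(2) I])
  have off: "slice_holo I (?D \<inter> {z. Im z \<noteq> 0}) ?F"
    unfolding slice_holo_def
  proof
    fix z assume z: "z \<in> ?D \<inter> {z. Im z \<noteq> 0}"
    then have x: "slice_emb I z \<in> nonreal_part \<Omega>"
      by (simp add: nonreal_part_def slice_emb_in_Reals_iff [OF I] mem_slice_base_iff [OF \<Omega>(2) I])
    then obtain f' where f': "(f has_derivative f') (at (slice_emb I z))"
      using C1 by (blast elim: C1_onD)
    have "dbar_slice I f (slice_emb I z) = 0"
      using theta_bar_eq_dbar_slice [OF I _ f'] theta x z by simp
    then show "\<exists>c. (?F has_derivative (\<lambda>v. slice_emb I v * c)) (at z)"
      using dbar_slice_eq_0_iff [OF I has_derivative_comp_slice_emb [OF f']]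
        has_derivative_comp_slice_emb [OF f'] by metis
  qed
  have "(\<lambda>z. slice_coord I (?F z * q)) holomorphic_on ?D" for q
  proof (rule holomorphic_on_paste_across_line [OF D, of \<i> _ 0])
    show "(\<lambda>z. slice_coord I (?F z * q)) holomorphic_on ?D \<inter> {z. \<i> \<bullet> z < 0}"
      "(\<lambda>z. slice_coord I (?F z * q)) holomorphic_on ?D \<inter> {z. 0 < \<i> \<bullet> z}"
      by (rule holomorphic_on_subset [OF slice_coord_holomorphic [OF I off]];
          auto simp: inner_complex_def)+
    show "continuous_on ?D (\<lambda>z. slice_coord I (?F z * q))"
      by (intro bounded_linear.continuous_on [OF bounded_linear_slice_coord] continuous_intros F_cont)
  qed simp
  from continuous_slice_derivative [OF I D this] show ?thesis
    unfolding slice_holo_def by metis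
qed

section \<open>From the slices to continuous differentiability\<close>

lemma has_derivative_norm_quat_Im:
  assumes "x \<notin> \<real>"
  shows "((\<lambda>y. norm (quat_Im y)) has_derivative (\<lambda>h. inner (slice_unit x) (quat_Im h))) (at x)"
proof -
  have "quat_Im x \<noteq> 0"
    using assms by (simp add: quat_Im_eq_0_iff)
  then have "(norm has_derivative (\<lambda>h. inner h (sgn (quat_Im x)))) (at (quat_Im x))"
    by (rule has_derivative_norm)
  from has_derivative_compose [OF bounded_linear_imp_has_derivative [OF bounded_linear_quat_Im] this]
  show ?thesis
    by (simp add: slice_unit_def sgn_div_norm inner_commute)
qed

lemma has_derivative_slice_proj:
  assumes "x \<notin> \<real>"
  shows "(slice_proj has_derivative (\<lambda>h. Complex (qRe h) (inner (slice_unit x) (quat_Im h)))) (at x)"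
proof -
  have "((\<lambda>y. of_real (qRe y) + \<i> * of_real (norm (quat_Im y))) has_derivative
     (\<lambda>h. of_real (qRe h) + \<i> * of_real (inner (slice_unit x) (quat_Im h)))) (at x)"
    by (intro has_derivative_add has_derivative_mult_right has_derivative_norm_quat_Im [OF assms]
        bounded_linear.has_derivative [OF bounded_linear_of_real]
        bounded_linear_imp_has_derivative [OF bounded_linear_qRe])
  then show ?thesis
    by (simp add: slice_proj_def [abs_def] Complex_eq)
qed

lemma has_derivative_slice_unit:
  assumes "x \<notin> \<real>"
  shows "(slice_unit has_derivative (\<lambda>h. (quat_Im h - inner (slice_unit x) (quat_Im h) *\<^sub>R slice_unit x)
    /\<^sub>R norm (quat_Im x))) (at x)"
proof -
  have n: "norm (quat_Im x) \<noteq> 0"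
    using assms by (simp add: quat_Im_eq_0_iff)
  have "((\<lambda>y. inverse (norm (quat_Im y))) has_derivative
      (\<lambda>h. - (inverse (norm (quat_Im x)) * inner (slice_unit x) (quat_Im h) * inverse (norm (quat_Im x))))) (at x)"
    by (rule Deriv.has_derivative_inverse [OF n has_derivative_norm_quat_Im [OF assms]])
  from has_derivative_scaleR [OF this bounded_linear_imp_has_derivative [OF bounded_linear_quat_Im]]
  show ?thesis
    by (simp add: slice_unit_def [abs_def] algebra_simps)
qed

text \<open>
  The second summand comes from the rotation of the unit: its derivative is the part of \<open>h\<close>
  orthogonal to the slice plane of \<open>x\<close>, divided by the distance of \<open>x\<close> to the real axis. If
  \<open>A x\<close> and \<open>B x\<close> are values of a function at two conjugate points, then the last factor over
  that distance is what is called the spherical derivative.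
\<close>

lemma has_derivative_blend_unit:
  assumes x: "x \<notin> \<real>"
    and A: "(A has_derivative A') (at x)" and B: "(B has_derivative B') (at x)"
  shows "((\<lambda>y. slice_blend I (slice_unit y) (A y) (B y)) has_derivative
    (\<lambda>h. slice_blend I (slice_unit x) (A' h) (B' h) +
      ((quat_Im h - inner (slice_unit x) (quat_Im h) *\<^sub>R slice_unit x) /\<^sub>R norm (quat_Im x)) *
      ((1/2) *\<^sub>R (I * (B x - A x))))) (at x)"
proof -
  let ?U = "slice_unit"
  let ?U' = "\<lambda>h. (quat_Im h - inner (?U x) (quat_Im h) *\<^sub>R ?U x) /\<^sub>R norm (quat_Im x)"
  have UI: "((\<lambda>y. ?U y * I) has_derivative (\<lambda>h. ?U' h * I)) (at x)"
    by (intro has_derivative_mult_left has_derivative_slice_unit [OF x])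
  have "((\<lambda>y. (1/2) *\<^sub>R ((1 - ?U y * I) * A y + (1 + ?U y * I) * B y)) has_derivative
    (\<lambda>h. (1/2) *\<^sub>R (((1 - ?U x * I) * A' h + (0 - ?U' h * I) * A x) +
       ((1 + ?U x * I) * B' h + (0 + ?U' h * I) * B x)))) (at x)"
    by (intro has_derivative_scaleR_right has_derivative_add has_derivative_mult has_derivative_diff
        has_derivative_const UI A B)
  moreover have "(1/2) *\<^sub>R (((1 - ?U x * I) * a + (0 - u * I) * A x) +
       ((1 + ?U x * I) * b + (0 + u * I) * B x)) =
     slice_blend I (?U x) a b + u * ((1/2) *\<^sub>R (I * (B x - A x)))" for a b u
    by (simp add: slice_blend_def scaleR_add_right [symmetric] mult.assoc [symmetric])
      (simp add: algebra_simps)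
  ultimately show ?thesis
    by (simp only: slice_blend_def)
qed

lemma closed_quat_Reals: "closed (\<real> :: quat set)"
proof -
  have "closed {x. quat_Im x = 0}"
    by (intro closed_Collect_eq linear_continuous_on bounded_linear_quat_Im continuous_on_const)
  then show ?thesis
    by (simp add: quat_Im_eq_0_iff)
qed

lemma norm_slice_proj_diff_real:
  assumes "x \<in> \<real>"
  shows "norm (slice_proj y - slice_proj x) = norm (y - x)"
proof -
  obtain K where K: "K \<in> imag_units" and y: "slice_emb K (slice_proj y) = y"
    using slice_emb_proj [of y] by blast
  have x: "slice_emb K (slice_proj x) = x"
    by (rule slice_emb_proj_real(1) [OF assms])
  have "norm (slice_proj y - slice_proj x) = norm (slice_emb K (slice_proj y - slice_proj x))"
    by (simp add: norm_slice_emb [OF K])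
  also have "\<dots> = norm (y - x)"
    by (simp only: linear_diff [OF bounded_linear.linear [OF bounded_linear_slice_emb]] x y)
  finally show ?thesis .
qed

lemma abs_qRe_le_norm: "\<bar>qRe h\<bar> \<le> norm h"
proof -
  have "\<bar>inner h 1\<bar> \<le> norm h * norm (1 :: quat)"
    by (rule Cauchy_Schwarz_ineq2)
  then show ?thesis
    by (simp add: inner_quat_def)
qed

lemma norm_quat_Im_le: "norm (quat_Im h) \<le> norm h"
  by (simp add: norm_quat_def inner_quat_def)

lemma slice_decomposition:
  assumes K: "K \<in> imag_units"
  defines "v h \<equiv> Complex (qRe h) (inner K (quat_Im h))"
    and "p h \<equiv> quat_Im h - inner K (quat_Im h) *\<^sub>R K"
  shows "h = slice_emb K (v h) + p h" "norm (v h) \<le> 2 * norm h" "norm (p h) \<le> 2 * norm h"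
proof -
  show "h = slice_emb K (v h) + p h"
    using quat_Re_Im [of h] by (simp add: v_def p_def slice_emb_eq_scaleR of_real_def)
  have i: "\<bar>inner K (quat_Im h)\<bar> \<le> norm h"
    using Cauchy_Schwarz_ineq2 [of K "quat_Im h"] norm_quat_Im_le [of h]
    by (simp add: imag_unitsD(2) [OF K])
  show "norm (v h) \<le> 2 * norm h"
    using cmod_le [of "v h"] i abs_qRe_le_norm [of h] by (simp add: v_def)
  show "norm (p h) \<le> 2 * norm h"
    using norm_triangle_ineq4 [of "quat_Im h" "inner K (quat_Im h) *\<^sub>R K"] i norm_quat_Im_le [of h]
    by (simp add: p_def imag_unitsD(2) [OF K])
qed

text \<open>
  The mean value inequality for \<open>F z - (\<alpha> + I\<beta>) c0\<close>. With \<open>u\<close> and \<open>w\<close> conjugate to each other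
  and \<open>c0\<close> the derivative at a nearby real point, it controls the difference quotient that forms
  the spherical derivative.
\<close>

lemma slice_strict_derivative:
  assumes I: "I \<in> imag_units" and "convex S"
    and F: "\<And>z. z \<in> S \<Longrightarrow> (F has_derivative (\<lambda>v. slice_emb I v * c z)) (at z)"
    and c: "\<And>z. z \<in> S \<Longrightarrow> norm (c z - c0) \<le> e"
    and "u \<in> S" "w \<in> S"
  shows "norm ((F u - slice_emb I u * c0) - (F w - slice_emb I w * c0)) \<le> e * norm (u - w)"
proof (rule differentiable_bound [OF \<open>convex S\<close> _ _ \<open>u \<in> S\<close> \<open>w \<in> S\<close>])
  fix z assume z: "z \<in> S"
  show "((\<lambda>z. F z - slice_emb I z * c0) has_derivative
      (\<lambda>v. slice_emb I v * c z - slice_emb I v * c0)) (at z within S)"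
    by (intro has_derivative_diff has_derivative_mult_left has_derivative_at_withinI [OF F [OF z]]
        bounded_linear_imp_has_derivative bounded_linear_slice_emb)
  show "onorm (\<lambda>v. slice_emb I v * c z - slice_emb I v * c0) \<le> e"
  proof (rule onorm_le)
    show "norm (slice_emb I v * c z - slice_emb I v * c0) \<le> e * norm v" for v
      using mult_left_mono [OF c [OF z] norm_ge_zero [of v]]
      by (simp add: right_diff_distrib [symmetric] norm_mult norm_slice_emb [OF I] mult.commute)
  qed
qed

text \<open>
  Blending the first order expansions of \<open>F\<close> at \<open>z\<close> and at its conjugate yields the first order
  expansion of \<open>f\<close> at a real point directly: by \<open>slice_blend_slice_emb\<close> the linear terms blend to
  \<open>(y - x) c\<close>, and the remainders only add up.
\<close>

lemma has_derivative_real_point: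
  assumes \<Omega>: "open \<Omega>" "circular \<Omega>" and I: "I \<in> imag_units" and x: "x \<in> \<Omega>" "x \<in> \<real>"
    and F: "(F has_derivative (\<lambda>v. slice_emb I v * c)) (at (slice_proj x))"
    and f: "\<And>K z. K \<in> imag_units \<Longrightarrow> z \<in> slice_base \<Omega> \<Longrightarrow>
      f (slice_emb K z) = slice_blend I K (F z) (F (cnj z))"
  shows "(f has_derivative (\<lambda>h. h * c)) (at x)"
  unfolding has_derivative_at_alt
proof (intro conjI allI impI)
  let ?a = "slice_proj x"
  note x_real = slice_emb_proj_real [OF x(2)]
  show "bounded_linear (\<lambda>h. h * c)"
    by (rule bounded_linear_mult_left)
  fix e :: real assume "e > 0"
  then have "e/2 > 0"
    by simp
  with F obtain d where d: "d > 0" and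
    Fd: "\<And>w. norm (w - ?a) < d \<Longrightarrow>
      norm (F w - F ?a - slice_emb I (w - ?a) * c) \<le> e/2 * norm (w - ?a)"
    unfolding has_derivative_at_alt by blast
  obtain r where r: "r > 0" "ball x r \<subseteq> \<Omega>"
    using \<Omega>(1) x(1) by (meson openE)
  have "norm (f y - f x - (y - x) * c) \<le> e * norm (y - x)" if y: "norm (y - x) < min d r" for y
  proof -
    obtain K where K: "K \<in> imag_units" and yK: "slice_emb K (slice_proj y) = y"
      using slice_emb_proj [of y] by blast
    let ?z = "slice_proj y"
    have n: "norm (?z - ?a) = norm (y - x)"
      by (rule norm_slice_proj_diff_real [OF x(2)])
    moreover have ca: "cnj ?z - ?a = cnj (?z - ?a)"
      using x_real(2) by simp
    ultimately have n': "norm (cnj ?z - ?a) = norm (y - x)"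
      by (metis complex_mod_cnj)
    have "y \<in> \<Omega>"
      using r(2) y by (auto simp: dist_norm norm_minus_commute)
    then have fy: "f y = slice_blend I K (F ?z) (F (cnj ?z))"
      using f [OF K slice_proj_in_base [OF \<Omega>(2)], of y] yK by simp
    have fx: "f x = slice_blend I K (F ?a) (F ?a)"
      using f [OF K slice_proj_in_base [OF \<Omega>(2) x(1)]] x_real by simp
    have "y - x = slice_emb K (?z - ?a)"
      by (simp add: linear_diff [OF bounded_linear.linear [OF bounded_linear_slice_emb]] x_real(1) yK)
    then have "(y - x) * c = slice_blend I K (slice_emb I (?z - ?a) * c) (slice_emb I (cnj ?z - ?a) * c)"
      unfolding ca slice_blend_slice_emb [OF I K] by simp
    then have "norm (f y - f x - (y - x) * c) =
        norm (slice_blend I K (F ?z - F ?a - slice_emb I (?z - ?a) * c)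
          (F (cnj ?z) - F ?a - slice_emb I (cnj ?z - ?a) * c))"
      by (simp only: fy fx slice_blend_diff)
    also have "\<dots> \<le> e/2 * norm (?z - ?a) + e/2 * norm (cnj ?z - ?a)"
      using y n n' by (intro order_trans [OF norm_slice_blend_le [OF I K]] add_mono Fd) auto
    finally show ?thesis
      by (simp add: n n')
  qed
  then show "\<exists>d>0. \<forall>y. norm (y - x) < d \<longrightarrow> norm (f y - f x - (y - x) * c) \<le> e * norm (y - x)"
    using d r(1) by (intro exI [of _ "min d r"]) auto
qed

text \<open>
  Off the real axis \<open>f\<close> is a blend of \<open>C\<^sup>1\<close> functions, and its derivative multiplies the part of an
  increment along the slice by the slice derivative and the orthogonal part by the
  spherical derivative. At a real point both factors tend to the same limit, the derivative of \<open>F\<close>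
  there, because \<open>F\<close> is holomorphic; so the two parts recombine in the limit.
\<close>

lemma slice_blend_C1:
  assumes \<Omega>: "open \<Omega>" "circular \<Omega>" and I: "I \<in> imag_units"
    and c: "continuous_on (slice_base \<Omega>) c"
    and F: "\<And>z. z \<in> slice_base \<Omega> \<Longrightarrow> (F has_derivative (\<lambda>v. slice_emb I v * c z)) (at z)"
    and f: "\<And>K z. K \<in> imag_units \<Longrightarrow> z \<in> slice_base \<Omega> \<Longrightarrow>
      f (slice_emb K z) = slice_blend I K (F z) (F (cnj z))"
  shows "f \<in> C1_on \<Omega>"
proof -
  let ?D = "slice_base \<Omega>"
  note proj_in = slice_proj_in_base [OF \<Omega>(2)]
  note cnj_in = iffD2 [OF slice_base_cnj [OF \<Omega>(2)]]
  have D: "open ?D"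
    by (rule open_slice_base [OF \<Omega>(2,1)])
  define par where "par x h =
    slice_emb (slice_unit x) (Complex (qRe h) (inner (slice_unit x) (quat_Im h))) *
      slice_blend I (slice_unit x) (c (slice_proj x)) (c (cnj (slice_proj x)))" for x h
  define perp where "perp x h =
    ((quat_Im h - inner (slice_unit x) (quat_Im h) *\<^sub>R slice_unit x) /\<^sub>R norm (quat_Im x)) *
      ((1/2) *\<^sub>R (I * (F (cnj (slice_proj x)) - F (slice_proj x))))" for x h
  define f' where "f' x h = (if x \<in> \<real> then h * c (slice_proj x) else par x h + perp x h)" for x h
  have open_nonreal: "open (\<Omega> - \<real>)"
    by (intro open_Diff \<Omega> closed_quat_Reals)
  have f_nonreal: "slice_blend I (slice_unit y) (F (slice_proj y)) (F (cnj (slice_proj y))) = f y"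
    if "y \<in> \<Omega> - \<real>" for y
    using f [of "slice_unit y" "slice_proj y"] proj_in [of y] that
    by (simp add: slice_unit_imag_unit slice_emb_unit_proj)
  have deriv_nonreal: "(f has_derivative f' x) (at x)" if x: "x \<in> \<Omega> - \<real>" for x
  proof -
    let ?v = "\<lambda>h. Complex (qRe h) (inner (slice_unit x) (quat_Im h))"
    have xR: "x \<notin> \<real>" and z: "slice_proj x \<in> ?D" "cnj (slice_proj x) \<in> ?D"
      using x proj_in [of x] cnj_in [of "slice_proj x"] by simp_all
    have "((\<lambda>y. F (slice_proj y)) has_derivative (\<lambda>h. slice_emb I (?v h) * c (slice_proj x))) (at x)"
      by (rule has_derivative_compose [OF has_derivative_slice_proj [OF xR] F [OF z(1)]])
    moreover have "((\<lambda>y. F (cnj (slice_proj y))) has_derivative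
        (\<lambda>h. slice_emb I (cnj (?v h)) * c (cnj (slice_proj x)))) (at x)"
      by (rule has_derivative_compose [OF bounded_linear.has_derivative [OF bounded_linear_cnj
            has_derivative_slice_proj [OF xR]] F [OF z(2)]])
    ultimately have "((\<lambda>y. slice_blend I (slice_unit y) (F (slice_proj y)) (F (cnj (slice_proj y))))
        has_derivative (\<lambda>h. par x h + perp x h)) (at x)"
      unfolding par_def perp_def slice_blend_slice_emb [OF I slice_unit_imag_unit [OF xR], symmetric]
      by (rule has_derivative_blend_unit [OF xR])
    moreover have "f' x = (\<lambda>h. par x h + perp x h)"
      using xR by (simp add: f'_def fun_eq_iff)
    ultimately show ?thesis
      by (intro has_derivative_transform_within_open [OF _ open_nonreal x f_nonreal]) simp_all
  qed
  have proj_real: "slice_proj x \<in> ?D" "cnj (slice_proj x) = slice_proj x"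
    "slice_emb K (slice_proj x) = x" if "x \<in> \<Omega> \<inter> \<real>" for x K
    using that proj_in [of x] slice_emb_proj_real [of x] by simp_all
  have deriv_real: "(f has_derivative f' x) (at x)" if x: "x \<in> \<Omega> \<inter> \<real>" for x
  proof -
    have "(f has_derivative (\<lambda>h. h * c (slice_proj x))) (at x)"
      using x by (intro has_derivative_real_point [OF \<Omega> I _ _ F [OF proj_real(1) [OF x]] f]) auto
    moreover have "f' x = (\<lambda>h. h * c (slice_proj x))"
      using x by (simp add: f'_def fun_eq_iff)
    ultimately show ?thesis
      by simp
  qed
  have cont_nonreal: "continuous (at x) (\<lambda>x. f' x h)" if x: "x \<in> \<Omega> - \<real>" for x h
  proof -
    have U: "continuous_on (\<Omega> - \<real>) slice_unit"
      using has_derivative_continuous [OF has_derivative_slice_unit]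
      by (intro continuous_at_imp_continuous_on ballI) simp
    have Fcont: "continuous_on ?D F"
      using has_derivative_continuous [OF F] by (intro continuous_at_imp_continuous_on ballI) simp
    have Z: "continuous_on (\<Omega> - \<real>) (\<lambda>x. G (slice_proj x))"
      "continuous_on (\<Omega> - \<real>) (\<lambda>x. G (cnj (slice_proj x)))"
      if "continuous_on ?D G" for G :: "complex \<Rightarrow> quat"
      by (rule continuous_on_compose2 [OF that];
          intro continuous_intros subsetI; elim imageE; simp add: proj_in cnj_in)+
    have "continuous_on (\<Omega> - \<real>) (\<lambda>x. par x h + perp x h)"
      unfolding par_def perp_def slice_blend_def slice_emb_eq_scaleR complex.sel
      by (intro continuous_intros U Z [OF c] Z [OF Fcont] bounded_linear.continuous_on [OF bounded_linear_quat_Im])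
        (auto simp: quat_Im_eq_0_iff)
    then have "continuous_on (\<Omega> - \<real>) (\<lambda>x. f' x h)"
      by (rule continuous_on_eq) (simp add: f'_def)
    then show ?thesis
      using x continuous_on_eq_continuous_at [OF open_nonreal] by blast
  qed
  have cont_real: "continuous (at x) (\<lambda>x. f' x h)" if x: "x \<in> \<Omega> \<inter> \<real>" for x h
    unfolding continuous_at_eps_delta
  proof (intro allI impI)
    let ?a = "slice_proj x"
    fix e0 :: real assume e0: "e0 > 0"
    \<comment> \<open>The bound below is \<open>6 * norm h * e\<close>; adding \<open>1\<close> keeps the denominator positive when \<open>h = 0\<close>.\<close>
    define e where "e = e0 / (6 * norm h + 1)"
    have e: "e > 0" "6 * norm h * e < e0"
      using e0 by (auto simp: e_def field_simps add_pos_nonneg)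
    have "continuous (at ?a) c"
      using c proj_real(1) [OF x] continuous_on_eq_continuous_at [OF D] by blast
    then obtain d1 where d1: "d1 > 0" "\<And>w. dist w ?a < d1 \<Longrightarrow> dist (c w) (c ?a) < e"
      using e(1) unfolding continuous_at_eps_delta by metis
    obtain d2 where d2: "d2 > 0" "ball ?a d2 \<subseteq> ?D"
      using D proj_real(1) [OF x] by (meson openE)
    define d where "d = min d1 d2"
    have d: "d > 0"
      using d1(1) d2(1) by (simp add: d_def)
    have dD: "w \<in> ?D" if "w \<in> ball ?a d" for w
      using d2(2) that by (auto simp: d_def)
    have dc: "norm (c w - c ?a) \<le> e" if "w \<in> ball ?a d" for w
      using d1(2) [of w] that by (simp add: d_def dist_commute dist_norm)
    have strict: "norm ((F u - slice_emb I u * c ?a) - (F w - slice_emb I w * c ?a)) \<le> e * norm (u - w)"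
      if "u \<in> ball ?a d" "w \<in> ball ?a d" for u w
      using slice_strict_derivative [OF I convex_ball F [OF dD] dc that] by blast
    have "norm (f' y h - f' x h) \<le> 6 * norm h * e" if y: "norm (y - x) < d" for y
    proof -
      let ?z = "slice_proj y"
      have n: "norm (?z - ?a) = norm (y - x)"
        using norm_slice_proj_diff_real x by blast
      have "norm (cnj ?z - ?a) = norm (cnj (?z - ?a))"
        using proj_real(2) [OF x] by simp
      then have n': "norm (cnj ?z - ?a) = norm (y - x)"
        by (metis complex_mod_cnj n)
      have z: "?z \<in> ball ?a d" "cnj ?z \<in> ball ?a d"
        using y n n' by (simp_all add: dist_norm norm_minus_commute)
      have f'x: "f' x h = h * c ?a"
        using x by (simp add: f'_def)
      show ?thesis
      proof (cases "y \<in> \<real>")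
        case True
        then have "norm (f' y h - f' x h) = norm h * norm (c ?z - c ?a)"
          unfolding f'x by (simp add: f'_def norm_mult flip: right_diff_distrib)
        also have "\<dots> \<le> norm h * e"
          by (intro mult_left_mono dc z) simp
        also have "\<dots> \<le> 6 * norm h * e"
          using e(1) by simp
        finally show ?thesis .
      next
        case False
        let ?K = "slice_unit y" and ?b = "norm (quat_Im y)"
        let ?v = "Complex (qRe h) (inner ?K (quat_Im h))"
        let ?p = "quat_Im h - inner ?K (quat_Im h) *\<^sub>R ?K"
        \<comment> \<open>\<open>?s\<close> is the spherical derivative at \<open>y\<close>, the difference quotient over two conjugate points.\<close>
        let ?s = "(1 / (2 * ?b)) *\<^sub>R (I * (F (cnj ?z) - F ?z))"
        have K: "?K \<in> imag_units"
          by (rule slice_unit_imag_unit [OF False])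
        note dec = slice_decomposition [OF K, of h]
        have b: "?b > 0"
          using False by (simp add: quat_Im_eq_0_iff)
        have "slice_emb I ?z - slice_emb I (cnj ?z) = (2 * ?b) *\<^sub>R I"
          by (simp add: slice_emb_eq_scaleR slice_proj_def flip: scaleR_add_left)
        then have "(F ?z - slice_emb I ?z * c ?a) - (F (cnj ?z) - slice_emb I (cnj ?z) * c ?a)
            = (F ?z - F (cnj ?z)) - (2 * ?b) *\<^sub>R I * c ?a"
          by (simp add: algebra_simps flip: left_diff_distrib)
        also have "\<dots> = (2 * ?b) *\<^sub>R I * (?s - c ?a)"
          using b imag_unitsD(1) [OF I]
          by (simp add: right_diff_distrib scaleR_diff_right flip: mult.assoc)
        finally have "(2 * ?b) * norm (?s - c ?a) \<le> e * norm (?z - cnj ?z)"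
          using strict [OF z] b by (simp add: norm_mult imag_unitsD(2) [OF I])
        moreover have "norm (?z - cnj ?z) = 2 * ?b"
          by (simp add: complex_diff_cnj norm_mult slice_proj_def)
        \<comment> \<open>For \<open>2 * ?b\<close> is exactly the distance between the two conjugate points.\<close>
        ultimately have s: "norm (?s - c ?a) \<le> e"
          using b by simp
        have "f' y h = slice_emb ?K ?v * slice_blend I ?K (c ?z) (c (cnj ?z)) + ?p * ?s"
          using False b by (simp add: f'_def par_def perp_def divide_simps)
        moreover have "h * c ?a = slice_emb ?K ?v * slice_blend I ?K (c ?a) (c ?a) + ?p * c ?a"
          using dec(1) by (metis distrib_right slice_blend_self)
        ultimately have "f' y h - f' x h = slice_emb ?K ?v *
            slice_blend I ?K (c ?z - c ?a) (c (cnj ?z) - c ?a) + ?p * (?s - c ?a)"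
          unfolding f'x slice_blend_diff [symmetric] by (simp only: right_diff_distrib) simp
        also have "norm \<dots> \<le> norm ?v * (norm (c ?z - c ?a) + norm (c (cnj ?z) - c ?a)) +
            norm ?p * norm (?s - c ?a)"
          by (intro norm_triangle_le add_mono)
            (simp_all add: norm_mult norm_slice_emb [OF K] mult_left_mono norm_slice_blend_le [OF I K])
        also have "\<dots> \<le> (2 * norm h) * (e + e) + (2 * norm h) * e"
          by (intro add_mono mult_mono dec dc z s) auto
        finally show ?thesis
          by (simp add: mult.commute mult.left_commute)
      qed
    qed
    then show "\<exists>d>0. \<forall>y. dist y x < d \<longrightarrow> dist (f' y h) (f' x h) < e0"
      using d e(2) unfolding dist_norm by (meson le_less_trans)
  qed
  show ?thesis
  proof (rule C1_onI)
    show "(f has_derivative f' x) (at x)" if "x \<in> \<Omega>" for x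
      using deriv_real deriv_nonreal that by blast
    show "continuous_on \<Omega> (\<lambda>x. f' x h)" for h
      using cont_real cont_nonreal by (intro continuous_at_imp_continuous_on) blast
  qed
qed

section \<open>The characterizations of slice regularity\<close>

lemma slice_holo_imp_slice_regular:
  assumes \<Omega>: "open \<Omega>" "connected \<Omega>" "circular \<Omega>" "\<Omega> \<inter> \<real> \<noteq> {}"
    and holo: "\<And>K. K \<in> imag_units \<Longrightarrow> slice_holo K (slice_base \<Omega>) (f \<circ> slice_emb K)"
  shows "f \<in> slice_regular \<Omega>"
proof -
  let ?F = "f \<circ> slice_emb quat_i"
  obtain c where "continuous_on (slice_base \<Omega>) c"
    "\<And>z. z \<in> slice_base \<Omega> \<Longrightarrow> (?F has_derivative (\<lambda>v. slice_emb quat_i v * c z)) (at z)"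
    using continuous_slice_derivative [OF quat_i_imag_unit open_slice_base [OF \<Omega>(3,1)]
        slice_coord_holomorphic [OF quat_i_imag_unit holo [OF quat_i_imag_unit]]] by blast
  moreover have "f (slice_emb K z) = slice_blend quat_i K (?F z) (?F (cnj z))"
    if "K \<in> imag_units" "z \<in> slice_base \<Omega>" for K z
    using slice_representation [OF \<Omega> holo quat_i_imag_unit that] by simp
  ultimately have "f \<in> C1_on \<Omega>"
    by (rule slice_blend_C1 [OF \<Omega>(1,3) quat_i_imag_unit])
  then show ?thesis
    using slice_holo_imp_dbar_slice_eq_0 [OF \<Omega>(3) _ holo] by (simp add: slice_regular_def)
qed

theorem theorem2p9:
  fixes \<Omega> :: "quat set" and f :: "quat \<Rightarrow> quat"
  assumes "open \<Omega>" and "connected \<Omega>" and "\<Omega> \<noteq> {}" and "circular \<Omega>" and "\<Omega> \<inter> \<real> \<noteq> {}"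
  shows "(f \<in> slice_regular \<Omega> \<longleftrightarrow>
            f \<in> C1_sl \<Omega> \<and> (\<forall>I\<in>imag_units. \<forall>x\<in>slice_part \<Omega> I. dbar_slice I f x = 0)) \<and>
         (f \<in> slice_regular \<Omega> \<longleftrightarrow>
            f \<in> C0_sl \<Omega> \<and> f \<in> C1_on (nonreal_part \<Omega>) \<and>
            (\<forall>x\<in>nonreal_part \<Omega>. theta_bar f x = 0))"
proof (intro conjI iffI)
  note to_regular = slice_holo_imp_slice_regular [OF assms(1,2,4,5)]
  show "f \<in> slice_regular \<Omega>"
    if "f \<in> C1_sl \<Omega> \<and> (\<forall>I\<in>imag_units. \<forall>x\<in>slice_part \<Omega> I. dbar_slice I f x = 0)"
    using that by (intro to_regular C1_sl_imp_slice_holo [OF assms(4)]) auto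
  show "f \<in> slice_regular \<Omega>"
    if "f \<in> C0_sl \<Omega> \<and> f \<in> C1_on (nonreal_part \<Omega>) \<and> (\<forall>x\<in>nonreal_part \<Omega>. theta_bar f x = 0)"
    using that by (intro to_regular theta_bar_imp_slice_holo [OF assms(1,4)]) auto
  assume reg: "f \<in> slice_regular \<Omega>"
  then have C1: "f \<in> C1_on \<Omega>"
    by (simp add: slice_regular_def)
  show "f \<in> C1_sl \<Omega>"
    by (rule C1_on_imp_C1_sl [OF assms(4) C1])
  show "\<forall>I\<in>imag_units. \<forall>x\<in>slice_part \<Omega> I. dbar_slice I f x = 0"
    using reg by (simp add: slice_regular_def)
  show "f \<in> C1_on (nonreal_part \<Omega>)"
    by (rule C1_on_subset [OF C1]) (auto simp: nonreal_part_def)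
  show "\<forall>x\<in>nonreal_part \<Omega>. theta_bar f x = 0"
    using slice_regular_imp_theta_bar [OF reg] by blast
  have "continuous_on \<Omega> f"
    using C1 by (blast elim: C1_onD intro: continuous_at_imp_continuous_on has_derivative_continuous)
  then show "f \<in> C0_sl \<Omega>"
    by (auto simp: C0_sl_def slice_part_def intro: continuous_on_subset)
qed

end
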